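(* Let $K$ be a field and $T=K[\alpha]$, where $\alpha^2=0$ (that is, $T= K[x]/(x^2)$ and $\alpha=x+(x^2)$). Then $T$ has only finitely many maximal subrings if and only if $K$ has only finitely many maximal subrings. Moreover, in this case $|RgMax(T)|=1+|RgMax(K)|$.
   Context: All rings are commutative with $1\neq 0$ and subrings are unital. A proper subring $S$ of a ring $R$ is a maximal subring of $R$ if it is maximal with respect to inclusion among all proper subrings of $R$ (a subring of a field need not be a field). $RgMax(R)$ denotes the set of all maximal subrings of $R$. *)

theory Defs
  imports "HOL-Algebra.Algebra"
begin

definition maximal_subring :: "'a set \<Rightarrow> ('a, 'b) ring_scheme \<Rightarrow> bool" where
  "maximal_subring S R \<longleftrightarrow>
     subring S R \<and> S \<noteq> carrier R \<and>
     (\<forall>S'. subring S' R \<and> S' \<noteq> carrier R \<and> S \<subseteq> S' \<longrightarrow> S' = S)"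

definition RgMax :: "('a, 'b) ring_scheme \<Rightarrow> 'a set set" where
  "RgMax R = {S. maximal_subring S R}"

(* K[x]/(x^2); the element called alpha in K[alpha] is the residue class of x.
   The library's Rupt is the quotient of the polynomial ring by the principal ideal
   of an arbitrary polynomial, not only of an irreducible one. *)
definition dual_numbers :: "('a, 'b) ring_scheme \<Rightarrow> 'a list set ring" where
  "dual_numbers K = Rupt\<^bsub>K\<^esub> (carrier K) (X\<^bsub>K\<^esub> [^]\<^bsub>poly_ring K\<^esub> (2::nat))"

end

theory Submission
  imports Defs
begin

text \<open>Write \<open>N = K \<alpha>\<close> for the nilradical of \<open>T = K[\<alpha>]\<close>; it is a minimal ideal of square zero with
\<open>T / N = K\<close>. A maximal subring of \<open>T\<close> that contains \<open>N\<close> is the preimage of a maximal subring of \<open>K\<close>.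
One that does not contain \<open>N\<close> is a complement of \<open>N\<close>, that is, the graph \<open>{a + d(a) \<alpha>}\<close> of a derivation
\<open>d\<close> of \<open>K\<close> (\<open>maximal_subring_avoiding_nilradical\<close>); \<open>K\<close> itself is the graph of \<open>d = 0\<close>. So the statement
amounts to this: a field with a nonzero derivation has infinitely many maximal subrings
(\<open>derivation_zero_if_finite_RgMax\<close>).

If \<open>d x \<noteq> 0\<close>, then \<open>x\<close> is transcendental over a suitable subring of \<open>K\<close>. In characteristic zero the
constants of \<open>d\<close> serve, as a polynomial relation of least degree could be differentiated. In positive
characteristic the prime field serves, as derivations vanish on finite fields.

It remains to construct infinitely many maximal subrings from a transcendental \<open>x\<close>
(\<open>infinite_RgMax_if_transc\<close>). Choose a subring \<open>L\<close> maximal for \<open>x\<close> being transcendental over \<open>L\<close>; it is a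
field, and \<open>K\<close> is algebraic over \<open>L(x)\<close> (\<open>transcendence_complement\<close>). For nonconstant \<open>q\<close> in \<open>L[x]\<close>, a
subring of \<open>K\<close> that contains \<open>L[x]\<close> and is maximal with respect to missing \<open>1/q\<close> is a valuation ring by
Chevalley's argument (\<open>maximal_excluding_valuation\<close>), and it has rank one because \<open>L[x]\<close> is Euclidean and
\<open>K\<close> is algebraic over its fraction field; so it is a maximal subring
(\<open>exists_maximal_subring_without_inverse\<close>). Euclid's proof of the infinitude of primes, with these rings
in the role of the primes, shows that there are infinitely many of them.\<close>

section \<open>Polynomial values of bounded degree\<close>

text \<open>The values at \<open>x\<close> of the polynomials of degree less than \<open>n\<close> over \<open>L\<close>, built by Horner's
scheme exactly as \<open>simple_extension\<close> is. They filter \<open>simple_extension L x\<close> by degree, so that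
degree arguments can be carried out inside the ambient ring, also when \<open>x\<close> is algebraic over \<open>L\<close>.\<close>
primrec (in ring) poly_vals :: "'a set \<Rightarrow> 'a \<Rightarrow> nat \<Rightarrow> 'a set" where
  "poly_vals L x 0 = {\<zero>}"
| "poly_vals L x (Suc n) = {w \<otimes> x \<oplus> b | w b. w \<in> poly_vals L x n \<and> b \<in> L}"

lemma (in ring) poly_vals_SucI:
  "w \<in> poly_vals L x n \<Longrightarrow> b \<in> L \<Longrightarrow> w \<otimes> x \<oplus> b \<in> poly_vals L x (Suc n)"
  by (auto simp: poly_vals.simps(2))

lemma (in ring) poly_vals_SucE:
  assumes "v \<in> poly_vals L x (Suc n)"
  obtains w b where "w \<in> poly_vals L x n" "b \<in> L" "v = w \<otimes> x \<oplus> b"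
  using assms by (auto simp: poly_vals.simps(2))

declare (in ring) poly_vals.simps(2) [simp del]

lemma (in ring) poly_vals_in_carrier:
  assumes "L \<subseteq> carrier R" "x \<in> carrier R" "w \<in> poly_vals L x n"
  shows "w \<in> carrier R"
  using assms(3) by (induction n arbitrary: w) (use assms(1,2) in \<open>auto simp: poly_vals.simps(2)\<close>)

lemma (in ring) finite_poly_vals:
  assumes "finite L" shows "finite (poly_vals L x n)"
proof (induction n)
  case (Suc n)
  have "poly_vals L x (Suc n) = (\<lambda>(w, b). w \<otimes> x \<oplus> b) ` (poly_vals L x n \<times> L)"
    by (auto simp: poly_vals.simps(2))
  with Suc assms show ?case by (metis finite_SigmaI finite_imageI)
qed simp

locale poly_vals_over = cring R for R (structure) +
  fixes L x
  assumes sub: "subring L R" and x_carr: "x \<in> carrier R"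
begin

lemma L_carr: "b \<in> L \<Longrightarrow> b \<in> carrier R"
  using subringE(1)[OF sub] by auto

lemma carr: "w \<in> poly_vals L x n \<Longrightarrow> w \<in> carrier R"
  using poly_vals_in_carrier subringE(1)[OF sub] x_carr by blast

lemma zero: "\<zero> \<in> poly_vals L x n"
proof (induction n)
  case (Suc n)
  show ?case using poly_vals_SucI[OF Suc subringE(2)[OF sub]] x_carr by simp
qed simp

lemma scale: "b \<in> L \<Longrightarrow> w \<in> poly_vals L x n \<Longrightarrow> b \<otimes> w \<in> poly_vals L x n"
proof (induction n arbitrary: w)
  case (Suc n)
  then obtain v c where w: "v \<in> poly_vals L x n" "c \<in> L" "w = v \<otimes> x \<oplus> c"
    by (auto elim: poly_vals_SucE)
  have "b \<otimes> w = (b \<otimes> v) \<otimes> x \<oplus> b \<otimes> c"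
    unfolding w(3) using L_carr[OF Suc.prems(1)] L_carr[OF w(2)] carr[OF w(1)] x_carr by algebra
  then show ?case
    using poly_vals_SucI[OF Suc.IH[OF Suc.prems(1) w(1)] subringE(6)[OF sub Suc.prems(1) w(2)]]
    by simp
qed (simp add: L_carr)

lemma add: "v \<in> poly_vals L x n \<Longrightarrow> w \<in> poly_vals L x n \<Longrightarrow> v \<oplus> w \<in> poly_vals L x n"
proof (induction n arbitrary: v w)
  case (Suc n)
  then obtain v' c where v: "v' \<in> poly_vals L x n" "c \<in> L" "v = v' \<otimes> x \<oplus> c"
    by (auto elim: poly_vals_SucE)
  obtain w' b where w: "w' \<in> poly_vals L x n" "b \<in> L" "w = w' \<otimes> x \<oplus> b"
    using Suc.prems(2) by (auto elim: poly_vals_SucE)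
  have "v \<oplus> w = (v' \<oplus> w') \<otimes> x \<oplus> (c \<oplus> b)"
    unfolding w(3) v(3)
    using L_carr[OF v(2)] L_carr[OF w(2)] carr[OF w(1)] carr[OF v(1)] x_carr by algebra
  then show ?case
    using poly_vals_SucI[OF Suc.IH[OF v(1) w(1)] subringE(7)[OF sub v(2) w(2)]]
    by simp
qed simp

lemma uminus: "w \<in> poly_vals L x n \<Longrightarrow> \<ominus> w \<in> poly_vals L x n"
  using scale[OF subringE(5)[OF sub subringE(3)[OF sub]]] carr by (metis l_minus l_one one_closed)

lemma minus: "v \<in> poly_vals L x n \<Longrightarrow> w \<in> poly_vals L x n \<Longrightarrow> v \<ominus> w \<in> poly_vals L x n"
  using add uminus by (simp add: a_minus_def)

lemma shift: "w \<in> poly_vals L x n \<Longrightarrow> w \<otimes> x \<in> poly_vals L x (Suc n)"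
  using poly_vals_SucI[OF _ subringE(2)[OF sub], of w x n] carr x_carr by (metis m_closed r_zero)

lemma const: "b \<in> L \<Longrightarrow> b \<in> poly_vals L x (Suc n)"
  using poly_vals_SucI[OF zero[of n], of b] x_carr L_carr by simp

lemma mono_Suc: "w \<in> poly_vals L x n \<Longrightarrow> w \<in> poly_vals L x (Suc n)"
proof (induction n arbitrary: w)
  case 0
  then show ?case using zero[of "Suc 0"] by (simp del: poly_vals.simps(2))
next
  case (Suc n)
  obtain v b where "v \<in> poly_vals L x n" "b \<in> L" "w = v \<otimes> x \<oplus> b"
    using Suc.prems by (rule poly_vals_SucE)
  then show ?case using poly_vals_SucI Suc.IH by blast
qed

lemma mono: "w \<in> poly_vals L x n \<Longrightarrow> n \<le> m \<Longrightarrow> w \<in> poly_vals L x m"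
proof (induction m)
  case (Suc m)
  then show ?case using mono_Suc le_Suc_eq by blast
qed simp

lemma shift_pow: "w \<in> poly_vals L x n \<Longrightarrow> w \<otimes> x [^] k \<in> poly_vals L x (n + k)"
proof (induction k)
  case (Suc k)
  have "w \<otimes> x [^] Suc k = (w \<otimes> x [^] k) \<otimes> x"
    using carr[OF Suc.prems] x_carr by (simp add: m_assoc)
  then show ?case using shift Suc by simp
qed (simp add: carr)

lemma lead_mem: "b \<in> L \<Longrightarrow> b \<otimes> x [^] n \<in> poly_vals L x (Suc n)"
  using shift_pow[OF const[of b 0], of n] by simp

text \<open>Horner's scheme splits off the constant term; division and the comparison of degrees need the
leading term instead.\<close>
lemma top_decomp:
  assumes "w \<in> poly_vals L x (Suc n)"
  obtains b v where "b \<in> L" "v \<in> poly_vals L x n" "w = b \<otimes> x [^] n \<oplus> v"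
proof -
  have "\<exists>b v. b \<in> L \<and> v \<in> poly_vals L x n \<and> w = b \<otimes> x [^] n \<oplus> v"
    using assms
  proof (induction n arbitrary: w)
    case 0
    then have "w \<in> L" using x_carr L_carr by (auto simp: poly_vals.simps(2))
    then show ?case using L_carr[of w] x_carr by (intro exI[of _ w] exI[of _ \<zero>]) simp
  next
    case (Suc n)
    obtain u c where u: "u \<in> poly_vals L x (Suc n)" "c \<in> L" "w = u \<otimes> x \<oplus> c"
      using Suc.prems by (rule poly_vals_SucE)
    obtain b v where v: "b \<in> L" "v \<in> poly_vals L x n" "u = b \<otimes> x [^] n \<oplus> v"
      using Suc.IH[OF u(1)] by blast
    have "w = b \<otimes> (x [^] n \<otimes> x) \<oplus> (v \<otimes> x \<oplus> c)"
      unfolding u(3) v(3)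
      using L_carr[OF v(1)] L_carr[OF u(2)] carr[OF v(2)] x_carr nat_pow_closed[OF x_carr, of n]
      by algebra
    moreover have "v \<otimes> x \<oplus> c \<in> poly_vals L x (Suc n)"
      using poly_vals_SucI[OF v(2) u(2)] .
    ultimately show ?case using v(1) by (metis nat_pow_Suc)
  qed
  then show ?thesis using that by blast
qed

lemma mult:
  "v \<in> poly_vals L x n \<Longrightarrow> w \<in> poly_vals L x (Suc m) \<Longrightarrow> v \<otimes> w \<in> poly_vals L x (n + m)"
proof (induction n arbitrary: v)
  case 0
  then show ?case using carr[OF 0(2)] zero by simp
next
  case (Suc n)
  obtain u c where u: "u \<in> poly_vals L x n" "c \<in> L" "v = u \<otimes> x \<oplus> c"
    using Suc.prems(1) by (rule poly_vals_SucE)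
  have "v \<otimes> w = (u \<otimes> w) \<otimes> x \<oplus> c \<otimes> w"
    unfolding u(3)
    using L_carr[OF u(2)] carr[OF u(1)] carr[OF Suc.prems(2)] x_carr by algebra
  moreover have "(u \<otimes> w) \<otimes> x \<in> poly_vals L x (Suc n + m)"
    using shift[OF Suc.IH[OF u(1) Suc.prems(2)]] by simp
  moreover have "c \<otimes> w \<in> poly_vals L x (Suc n + m)"
    by (rule mono[OF scale[OF u(2) Suc.prems(2)]]) simp
  ultimately show ?case using add by simp
qed

lemma simple_extension_eq: "simple_extension L x = (\<Union>n. poly_vals L x n)"
proof
  show "simple_extension L x \<subseteq> (\<Union>n. poly_vals L x n)"
  proof
    fix w assume "w \<in> simple_extension L x"
    then show "w \<in> (\<Union>n. poly_vals L x n)"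
    proof (induction rule: simple_extension.induct)
      case zero
      show ?case using poly_vals.simps(1) by (intro UN_I[of 0]) simp_all
    next
      case (lin v b)
      then obtain n where "v \<in> poly_vals L x n" by blast
      from poly_vals_SucI[OF this lin.hyps(2)] show ?case by (rule UN_I[OF UNIV_I])
    qed
  qed
  have "w \<in> poly_vals L x n \<Longrightarrow> w \<in> simple_extension L x" for w n
  proof (induction n arbitrary: w)
    case (Suc n)
    obtain v b where v: "v \<in> poly_vals L x n" "b \<in> L" "w = v \<otimes> x \<oplus> b"
      using Suc.prems by (rule poly_vals_SucE)
    show ?case unfolding v(3) using Suc.IH[OF v(1)] v(2) by (rule simple_extension.lin)
  qed simp
  then show "(\<Union>n. poly_vals L x n) \<subseteq> simple_extension L x" by blast
qed

lemma simple_extensionI: "w \<in> poly_vals L x n \<Longrightarrow> w \<in> simple_extension L x"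
  using simple_extension_eq by auto

end

lemma (in cring) poly_vals_overI:
  "subring L R \<Longrightarrow> x \<in> carrier R \<Longrightarrow> poly_vals_over R L x"
  by (intro poly_vals_over.intro cring_axioms poly_vals_over_axioms.intro)

section \<open>Transcendental elements\<close>

text \<open>Transcendence of \<open>x\<close> over the subring \<open>L\<close>, stated without coefficients: in a relation
\<open>b = w x\<close> with \<open>w\<close> a polynomial value, the constant term \<open>b\<close> vanishes. In a domain \<open>x \<noteq> \<zero>\<close> can
then be cancelled, so inductively every coefficient of a polynomial relation for \<open>x\<close> vanishes.\<close>
definition (in ring) transc :: "'a set \<Rightarrow> 'a \<Rightarrow> bool" where
  "transc L x \<longleftrightarrow> x \<noteq> \<zero> \<and> (\<forall>b\<in>L. \<forall>w\<in>simple_extension L x. b = w \<otimes> x \<longrightarrow> b = \<zero>)"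

lemma (in ring) transcD:
  "transc L x \<Longrightarrow> b \<in> L \<Longrightarrow> w \<in> simple_extension L x \<Longrightarrow> b = w \<otimes> x \<Longrightarrow> b = \<zero>"
  by (auto simp: transc_def)

text \<open>Together with its converse below, this relates constant terms to leading terms: no power of a
transcendental \<open>x\<close> is reduced to lower degree by a nonzero leading coefficient.\<close>
lemma (in domain) transc_lead_coeff:
  assumes sub: "subring L R" and x: "x \<in> carrier R" and tr: "transc L x"
    and b: "b \<in> L" "b \<otimes> x [^] n \<in> poly_vals L x n"
  shows "b = \<zero>"
proof -
  interpret W: poly_vals_over R L x using sub x by (intro poly_vals_overI)
  show ?thesis using b(2)
  proof (induction n)
    case 0
    then show ?case using W.L_carr[OF b(1)] by simp
  next
    case (Suc n)
    then obtain w c where w: "w \<in> poly_vals L x n" "c \<in> L" "b \<otimes> x [^] Suc n = w \<otimes> x \<oplus> c"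
      by (auto elim: poly_vals_SucE)
    let ?u = "b \<otimes> x [^] n \<ominus> w"
    have car: "b \<in> carrier R" "w \<in> carrier R" "c \<in> carrier R" "x [^] n \<in> carrier R"
      using W.L_carr b(1) w W.carr x by auto
    have eq: "(b \<otimes> x [^] n) \<otimes> x = w \<otimes> x \<oplus> c"
      using w(3) car x by (simp add: m_assoc)
    have "c = (b \<otimes> x [^] n) \<otimes> x \<ominus> w \<otimes> x"
      unfolding eq using car x by algebra
    also have "\<dots> = ?u \<otimes> x" using car x by algebra
    finally have c: "c = ?u \<otimes> x" .
    have "?u \<in> poly_vals L x (Suc n)"
      using W.minus[OF W.lead_mem[OF b(1)] W.mono_Suc[OF w(1)]] .
    then have "c = \<zero>" using transcD[OF tr w(2) W.simple_extensionI c] by blast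
    then have "?u \<otimes> x = \<zero>" using c by simp
    moreover have "?u \<in> carrier R" using car by simp
    ultimately have "?u = \<zero>" using integral x tr unfolding transc_def by blast
    then have "b \<otimes> x [^] n = w" using car by (simp add: r_right_minus_eq)
    then show ?case using Suc.IH w(1) by simp
  qed
qed

lemma (in domain) transcI_lead_coeff:
  assumes sub: "subring L R" and x: "x \<in> carrier R" "x \<noteq> \<zero>"
    and lead: "\<And>n b. b \<in> L \<Longrightarrow> b \<otimes> x [^] n \<in> poly_vals L x n \<Longrightarrow> b = \<zero>"
  shows "transc L x"
proof -
  interpret W: poly_vals_over R L x using sub x by (intro poly_vals_overI)
  have *: "b = \<zero>" if "w \<in> poly_vals L x n" "b \<in> L" "b = w \<otimes> x" for n w b
    using that
  proof (induction n arbitrary: w)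
    case 0
    then show ?case using x by simp
  next
    case (Suc n)
    obtain c v where v: "c \<in> L" "v \<in> poly_vals L x n" "w = c \<otimes> x [^] n \<oplus> v"
      using Suc.prems(1) by (rule W.top_decomp)
    have car: "c \<in> carrier R" "v \<in> carrier R" "b \<in> carrier R" "x [^] n \<in> carrier R"
      using W.L_carr W.carr v Suc.prems x by auto
    have "b = c \<otimes> (x [^] n \<otimes> x) \<oplus> v \<otimes> x"
      unfolding Suc.prems(3) v(3) using car x by algebra
    then have "c \<otimes> (x [^] n \<otimes> x) = b \<ominus> v \<otimes> x" using car x by algebra
    then have "c \<otimes> x [^] Suc n = b \<ominus> v \<otimes> x" by simp
    then have "c \<otimes> x [^] Suc n \<in> poly_vals L x (Suc n)"
      using W.minus[OF W.const[OF Suc.prems(2)] W.shift[OF v(2)]] by simp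
    then have "c = \<zero>" by (rule lead[OF v(1)])
    then have "w = v" using v(3) car by simp
    then show ?case using Suc.IH[OF v(2)] Suc.prems by simp
  qed
  show ?thesis unfolding transc_def using * W.simple_extension_eq x(2) by blast
qed

text \<open>Degrees add under multiplication because the product of the leading coefficients is nonzero and,
by transcendence, cannot be absorbed by lower terms. Hence units have degree zero.\<close>
lemma (in domain) simple_extension_units:
  assumes sub: "subring L R" and x: "x \<in> carrier R" and tr: "transc L x"
    and fg: "f \<in> simple_extension L x" "g \<in> simple_extension L x" "f \<otimes> g = \<one>"
  shows "f \<in> L"
proof -
  interpret W: poly_vals_over R L x using sub x by (intro poly_vals_overI)
  have top: "\<exists>n c v. c \<in> L \<and> c \<noteq> \<zero> \<and> v \<in> poly_vals L x n \<and> h = c \<otimes> x [^] n \<oplus> v"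
    if h: "h \<in> simple_extension L x" "h \<noteq> \<zero>" for h
  proof -
    obtain k where "h \<in> poly_vals L x k" using h(1) unfolding W.simple_extension_eq by blast
    then show ?thesis
    proof (induction k)
      case 0
      then show ?case using h(2) by simp
    next
      case (Suc k)
      obtain c v where v: "c \<in> L" "v \<in> poly_vals L x k" "h = c \<otimes> x [^] k \<oplus> v"
        using Suc.prems by (rule W.top_decomp)
      show ?case
      proof (cases "c = \<zero>")
        case True
        then have "h = v" using v x W.carr by simp
        then show ?thesis using Suc.IH v(2) by simp
      qed (use v in blast)
    qed
  qed
  have car: "f \<in> carrier R" "g \<in> carrier R"
    using fg simple_extension_in_carrier[OF subringE(1)[OF sub] x] by auto
  then have nz: "f \<noteq> \<zero>" "g \<noteq> \<zero>" using fg(3) by auto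
  obtain n c v where f: "c \<in> L" "c \<noteq> \<zero>" "v \<in> poly_vals L x n" "f = c \<otimes> x [^] n \<oplus> v"
    using top[OF fg(1) nz(1)] by blast
  obtain m e w where g: "e \<in> L" "e \<noteq> \<zero>" "w \<in> poly_vals L x m" "g = e \<otimes> x [^] m \<oplus> w"
    using top[OF fg(2) nz(2)] by blast
  have cc: "c \<in> carrier R" "e \<in> carrier R" "v \<in> carrier R" "w \<in> carrier R"
      "x [^] n \<in> carrier R" "x [^] m \<in> carrier R"
    using W.L_carr W.carr f g x by auto
  show ?thesis
  proof (cases "n = 0")
    case True
    then show ?thesis using f cc by simp
  next
    case False
    have "\<one> = (c \<otimes> x [^] n) \<otimes> g \<oplus> v \<otimes> g"
      using fg(3) car cc unfolding f(4) by (simp add: l_distr)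
    also have "(c \<otimes> x [^] n) \<otimes> g = (c \<otimes> e) \<otimes> (x [^] n \<otimes> x [^] m) \<oplus> c \<otimes> (w \<otimes> x [^] n)"
      unfolding g(4) using cc by algebra
    also have "x [^] n \<otimes> x [^] m = x [^] (n + m)" using x by (simp add: nat_pow_mult)
    finally have one: "\<one> = (c \<otimes> e) \<otimes> x [^] (n + m) \<oplus> c \<otimes> (w \<otimes> x [^] n) \<oplus> v \<otimes> g" .
    have "g \<in> poly_vals L x (Suc m)"
      unfolding g(4) using W.add[OF W.lead_mem[OF g(1)] W.mono_Suc[OF g(3)]] .
    then have vg: "v \<otimes> g \<in> poly_vals L x (n + m)" using W.mult[OF f(3)] by blast
    have wx: "c \<otimes> (w \<otimes> x [^] n) \<in> poly_vals L x (n + m)"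
      using W.scale[OF f(1) W.shift_pow[OF g(3), of n]] by (simp add: add.commute)
    obtain k where k: "n + m = Suc k" using False by (cases "n + m") auto
    have o: "\<one> \<in> poly_vals L x (n + m)" unfolding k using W.const subringE(3)[OF sub] by blast
    have "(c \<otimes> e) \<otimes> x [^] (n + m) = \<one> \<ominus> c \<otimes> (w \<otimes> x [^] n) \<ominus> v \<otimes> g"
    proof -
      have "x [^] (n + m) \<in> carrier R" "w \<otimes> x [^] n \<in> carrier R" using x cc by auto
      moreover have "\<lbrakk>p \<in> carrier R; q \<in> carrier R; r \<in> carrier R\<rbrakk> \<Longrightarrow> 
          p = (p \<oplus> q \<oplus> r) \<ominus> q \<ominus> r" for p q r by algebra
      ultimately show ?thesis using cc car one by simp
    qed
    then have "(c \<otimes> e) \<otimes> x [^] (n + m) \<in> poly_vals L x (n + m)"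
      using W.minus[OF W.minus[OF o wx] vg] by simp
    then have "c \<otimes> e = \<zero>" by (rule transc_lead_coeff[OF sub x tr subringE(6)[OF sub f(1) g(1)]])
    then show ?thesis using f(2) g(2) integral cc by blast
  qed
qed

text \<open>The exchange property: two elements are algebraically independent in either order. A relation
\<open>u = v x\<close> with \<open>u\<close> in \<open>L[y]\<close> and \<open>v\<close> in \<open>L[x][y]\<close> is compared in its constant terms with respect to
\<open>y\<close>: transcendence of \<open>y\<close> over \<open>L[x]\<close> separates it into a relation over \<open>L\<close>, settled by
transcendence of \<open>x\<close>, and a relation for the remaining part of \<open>u\<close>, of smaller degree in \<open>y\<close>.\<close>
lemma (in domain) transc_exchange:
  assumes sub: "subring L R" and x: "x \<in> carrier R" and y: "y \<in> carrier R"
    and trx: "transc L x" and ty: "transc (simple_extension L x) y"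
  shows "transc (simple_extension L y) x"
proof -
  let ?Lx = "simple_extension L x" and ?Ly = "simple_extension L y"
  have subx: "subring ?Lx R" and suby: "subring ?Ly R"
    using simple_extension_is_subring sub x y by auto
  have carx: "b \<in> ?Lx \<Longrightarrow> b \<in> carrier R" and cary: "b \<in> ?Ly \<Longrightarrow> b \<in> carrier R"
    and carL: "b \<in> L \<Longrightarrow> b \<in> carrier R" for b
    using subringE(1)[OF subx] subringE(1)[OF suby] subringE(1)[OF sub] by auto
  have subxy: "subring (simple_extension ?Lx y) R" using simple_extension_is_subring subx y by auto
  have swap: "simple_extension ?Ly x \<subseteq> simple_extension ?Lx y"
  proof (rule simple_extension_subring_incl[OF subxy])
    show "?Ly \<subseteq> simple_extension ?Lx y"
      using mono_simple_extension[OF simple_extension_incl[OF subringE(1)[OF sub] x]] .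
    show "x \<in> simple_extension ?Lx y"
      using simple_extension_mem[OF sub x] simple_extension_incl[OF subringE(1)[OF subx] y] by auto
  qed
  have "u = \<zero>" if "u \<in> ?Ly" "v \<in> simple_extension ?Lx y" "u = v \<otimes> x" for u v
    using that
  proof (induction u arbitrary: v rule: simple_extension.induct)
    case zero
    then show ?case by simp
  next
    case (lin u b)
    have uc: "u \<in> carrier R" "b \<in> carrier R" using lin.hyps cary carL by auto
    have bL: "b \<in> ?Lx" using simple_extension_incl[OF subringE(1)[OF sub] x] lin.hyps(2) by auto
    have step: "u \<otimes> y \<oplus> b = \<zero>"
      if w: "w \<in> simple_extension ?Lx y" "c \<in> ?Lx" "u \<otimes> y \<oplus> b = (w \<otimes> y \<oplus> c) \<otimes> x" for w c
    proof -
      have wc: "w \<in> carrier R" "c \<in> carrier R" using w subringE(1)[OF subxy] carx by auto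
      let ?d = "b \<ominus> c \<otimes> x" and ?e = "w \<otimes> x \<ominus> u"
      have "?d = (u \<otimes> y \<oplus> b) \<ominus> u \<otimes> y \<ominus> c \<otimes> x" using uc wc x y by algebra
      also have "\<dots> = ?e \<otimes> y" unfolding w(3) using uc wc x y by algebra
      finally have d: "?d = ?e \<otimes> y" .
      have "c \<otimes> x \<in> ?Lx" using subringE(6)[OF subx w(2) simple_extension_mem[OF sub x]] .
      then have dL: "?d \<in> ?Lx" using bL subringE(5,7)[OF subx] by (simp add: a_minus_def)
      have x': "x \<in> simple_extension ?Lx y" "u \<in> simple_extension ?Lx y"
        using simple_extension_mem[OF sub x] simple_extension_incl[OF subringE(1)[OF subx] y] 
          lin.hyps(1) mono_simple_extension[OF simple_extension_incl[OF subringE(1)[OF sub] x]] by auto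
      then have "?e \<in> simple_extension ?Lx y"
        using w(1) subringE(5,6,7)[OF subxy] by (simp add: a_minus_def)
      then have d0: "?d = \<zero>" using transcD[OF ty dL _ d] by blast
      then have "?e \<otimes> y = \<zero>" using d by simp
      then have "?e = \<zero>" using integral[of ?e y] ty uc wc x y unfolding transc_def by auto
      then have "u = w \<otimes> x" using uc wc x by (metis m_closed r_right_minus_eq)
      then have "u = \<zero>" using lin.IH w(1) by blast
      moreover have "b = c \<otimes> x" using d0 uc wc x by simp
      then have "b = \<zero>" using transcD[OF trx lin.hyps(2) w(2)] by blast
      ultimately show ?thesis using y by simp
    qed
    from lin.prems(1) show ?case
    proof (cases rule: simple_extension.cases)
      case zero
      then show ?thesis using lin.prems(2) x by simp
    next
      case (lin w c)
      then show ?thesis using step[of w c] \<open>u \<otimes> y \<oplus> b = v \<otimes> x\<close> by blast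
    qed
  qed
  then show ?thesis using swap trx unfolding transc_def by blast
qed

lemma (in domain) clear_denominator:
  assumes sub: "subring L R" and ab: "a \<in> L" "b \<in> carrier R" "a \<otimes> b = \<one>"
    and w: "w \<in> simple_extension L b"
  shows "\<exists>N::nat. a [^] N \<otimes> w \<in> L"
  using w
proof (induction rule: simple_extension.induct)
  case zero
  then show ?case using subringE(2)[OF sub] ab(1) subringE(1)[OF sub] by auto
next
  case (lin v c)
  have carL: "e \<in> L \<Longrightarrow> e \<in> carrier R" for e using subringE(1)[OF sub] by auto
  have pow: "a [^] (k::nat) \<in> L" for k
    by (induction k) (use subringE(3,6)[OF sub] ab(1) in auto)
  obtain N where N: "a [^] (N::nat) \<otimes> v \<in> L" using lin by blast
  have vc: "v \<in> carrier R"
    using lin.hyps(1) simple_extension_in_carrier[OF subringE(1)[OF sub] ab(2)] by auto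
  have "a [^] Suc N \<otimes> (v \<otimes> b \<oplus> c) = (a [^] N \<otimes> v) \<otimes> (a \<otimes> b) \<oplus> a [^] Suc N \<otimes> c"
    using carL[OF pow, of N] carL[OF lin.hyps(2)] vc ab(2) carL[OF ab(1)]
    unfolding nat_pow_Suc by algebra
  also have "\<dots> = a [^] N \<otimes> v \<oplus> a [^] Suc N \<otimes> c" using carL[OF N] unfolding ab(3) by simp
  also have "\<dots> \<in> L" using subringE(6,7)[OF sub] N pow lin.hyps(2) by blast
  finally show ?case by blast
qed

text \<open>Multiplying a relation over \<open>L[1/a]\<close> by a power of \<open>a\<close> turns it into a relation over \<open>L\<close>.\<close>
lemma (in domain) transc_adjoin_inverse:
  assumes sub: "subring L R" and x: "x \<in> carrier R" and tr: "transc L x"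
    and ab: "a \<in> L" "b \<in> carrier R" "a \<otimes> b = \<one>"
  shows "transc (simple_extension L b) x"
proof -
  let ?Lb = "simple_extension L b" and ?Lx = "simple_extension L x"
  have carL: "e \<in> L \<Longrightarrow> e \<in> carrier R" for e using subringE(1)[OF sub] by auto
  have pow: "a [^] (k::nat) \<in> L" for k
    by (induction k) (use subringE(3,6)[OF sub] ab(1) in auto)
  have subb: "subring ?Lb R" and subx: "subring ?Lx R" using simple_extension_is_subring sub ab x by auto
  have incl: "L \<subseteq> ?Lx" using simple_extension_incl[OF subringE(1)[OF sub] x] .
  have cl: "\<exists>N::nat. a [^] N \<otimes> w \<in> ?Lx" if "w \<in> simple_extension ?Lb x" for w
    using that
  proof (induction rule: simple_extension.induct)
    case zero
    then show ?case using subringE(2)[OF subx] carL[OF ab(1)] by auto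
  next
    case (lin v c)
    obtain N where N: "a [^] (N::nat) \<otimes> v \<in> ?Lx" using lin by blast
    obtain M where M: "a [^] (M::nat) \<otimes> c \<in> L" using clear_denominator[OF sub ab lin.hyps(2)] by blast
    have vc: "v \<in> carrier R" "c \<in> carrier R"
      using lin.hyps simple_extension_in_carrier[OF subringE(1)[OF subb] x] subringE(1)[OF subb] by auto
    have "a [^] (N + M) \<otimes> (v \<otimes> x \<oplus> c) = (a [^] M \<otimes> (a [^] N \<otimes> v)) \<otimes> x \<oplus> a [^] N \<otimes> (a [^] M \<otimes> c)"
      using carL[OF pow, of N] carL[OF pow, of M] vc x carL[OF ab(1)]
      unfolding nat_pow_mult[OF carL[OF ab(1)], symmetric] by algebra
    also have "\<dots> \<in> ?Lx"
    proof (rule simple_extension.lin)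
      show "a [^] M \<otimes> (a [^] N \<otimes> v) \<in> ?Lx" using N pow incl subringE(6)[OF subx] by blast
      show "a [^] N \<otimes> (a [^] M \<otimes> c) \<in> L" using M pow subringE(6)[OF sub] by blast
    qed
    finally show ?case by blast
  qed
  have a0: "a \<noteq> \<zero>" using ab by auto
  have "u = \<zero>" if uw: "u \<in> ?Lb" "w \<in> simple_extension ?Lb x" "u = w \<otimes> x" for u w
  proof -
    obtain N where N: "a [^] (N::nat) \<otimes> w \<in> ?Lx" using cl[OF uw(2)] by blast
    obtain M where M: "a [^] (M::nat) \<otimes> u \<in> L" using clear_denominator[OF sub ab uw(1)] by blast
    have uc: "u \<in> carrier R" "w \<in> carrier R"
      using uw subringE(1)[OF subb] simple_extension_in_carrier[OF subringE(1)[OF subb] x] by auto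
    have c: "a [^] N \<in> carrier R" "a [^] M \<in> carrier R" using pow carL by auto
    have "a [^] N \<otimes> (a [^] M \<otimes> u) = a [^] M \<otimes> (a [^] N \<otimes> w) \<otimes> x"
      unfolding uw(3) using uc c x by algebra
    moreover have "a [^] N \<otimes> (a [^] M \<otimes> u) \<in> L" using M pow subringE(6)[OF sub] by blast
    moreover have "a [^] M \<otimes> (a [^] N \<otimes> w) \<in> ?Lx" using N pow incl subringE(6)[OF subx] by blast
    ultimately have "a [^] N \<otimes> (a [^] M \<otimes> u) = \<zero>" using transcD[OF tr] by blast
    moreover have "a [^] (k::nat) \<noteq> \<zero>" for k
      by (induction k) (use a0 carL[OF ab(1)] integral in auto)
    ultimately show ?thesis using integral uc c by (metis m_closed)
  qed
  then show ?thesis using tr unfolding transc_def by blast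
qed

lemma (in ring) subring_Union_chain:
  assumes "C \<noteq> {}" "\<And>S. S \<in> C \<Longrightarrow> subring S R"
    "\<And>S T. S \<in> C \<Longrightarrow> T \<in> C \<Longrightarrow> S \<subseteq> T \<or> T \<subseteq> S"
  shows "subring (\<Union>C) R"
proof (rule subringI)
  show "\<Union>C \<subseteq> carrier R" using subringE(1)[OF assms(2)] by blast
  obtain S where S: "S \<in> C" using assms(1) by blast
  then show "\<one> \<in> \<Union>C" using subringE(3)[OF assms(2)[OF S]] by blast
  show "\<ominus> h \<in> \<Union>C" if h: "h \<in> \<Union>C" for h
  proof -
    obtain S where "S \<in> C" "h \<in> S" using h by blast
    then show ?thesis using subringE(5)[OF assms(2)] by blast
  qed
  fix h k assume "h \<in> \<Union>C" "k \<in> \<Union>C"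
  then obtain S where S: "S \<in> C" "h \<in> S" "k \<in> S" using assms(3) by blast
  then show "h \<otimes> k \<in> \<Union>C" "h \<oplus> k \<in> \<Union>C"
    using subringE(6,7)[OF assms(2)[OF S(1)] S(2,3)] by blast+
qed

text \<open>Zorn's lemma applies because a polynomial relation involves only finitely many coefficients, and
these lie in a single member of a chain of subrings.\<close>
lemma (in domain) exists_maximal_transc:
  assumes x: "x \<in> carrier R" and L0: "subring L0 R" "transc L0 x"
  shows "\<exists>L. subring L R \<and> transc L x \<and> (\<forall>L'. subring L' R \<longrightarrow> transc L' x \<longrightarrow> L \<subseteq> L' \<longrightarrow> L' = L)"
proof -
  let ?A = "{L. subring L R \<and> transc L x}"
  have "\<exists>M\<in>?A. \<forall>S\<in>?A. M \<subseteq> S \<longrightarrow> S = M"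
  proof (rule subset_Zorn_nonempty)
    show "?A \<noteq> {}" using L0 by blast
    fix C assume C: "C \<noteq> {}" "subset.chain ?A C"
    then have chain: "S \<in> C \<Longrightarrow> T \<in> C \<Longrightarrow> S \<subseteq> T \<or> T \<subseteq> S" and mem: "S \<in> C \<Longrightarrow> S \<in> ?A" for S T
      unfolding subset.chain_def by auto
    have up: "\<exists>U\<in>C. w \<in> simple_extension U x \<and> b \<in> U"
      if "S \<in> C" "w \<in> simple_extension S x" "T \<in> C" "b \<in> T" for S T w b
    proof (cases "S \<subseteq> T")
      case True
      then show ?thesis using that mono_simple_extension[OF True, of x] by blast
    next
      case False
      then show ?thesis using that chain[of S T] by blast
    qed
    have ext: "\<exists>S\<in>C. w \<in> simple_extension S x" if "w \<in> simple_extension (\<Union>C) x" for w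
      using that
    proof (induction rule: simple_extension.induct)
      case zero
      then show ?case using C(1) by blast
    next
      case (lin v b)
      then obtain U where "U \<in> C" "v \<in> simple_extension U x" "b \<in> U" using up by blast
      then show ?case using simple_extension.lin by (intro bexI[of _ U])
    qed
    have "b = \<zero>" if b: "b \<in> \<Union>C" "w \<in> simple_extension (\<Union>C) x" "b = w \<otimes> x" for b w
    proof -
      obtain U where "U \<in> C" "w \<in> simple_extension U x" "b \<in> U" using ext[OF b(2)] b(1) up by blast
      then show ?thesis using mem transcD b(3) by blast
    qed
    then have "transc (\<Union>C) x" using L0(2) unfolding transc_def by blast
    moreover have "subring (\<Union>C) R"
      by (rule subring_Union_chain[OF C(1)]) (use mem chain in auto)
    ultimately show "\<Union>C \<in> ?A" by blast
  qed
  then show ?thesis by (simp add: Bex_def) blast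
qed

text \<open>A coefficient ring \<open>L\<close> that is maximal for transcendence of \<open>x\<close> is a field, since the inverse of
a nonzero element can be adjoined, and by exchange no element of the field is transcendental over
\<open>L[x]\<close>. So \<open>L(x)\<close> is a rational function field over which the whole field is algebraic.\<close>
lemma (in field) transcendence_complement:
  assumes x: "x \<in> carrier R" and L0: "subring L0 R" "transc L0 x"
  shows "\<exists>L. subring L R \<and> transc L x \<and> (\<forall>a\<in>L. a \<noteq> \<zero> \<longrightarrow> inv a \<in> L) \<and>
    (\<forall>y\<in>carrier R. \<not> transc (simple_extension L x) y)"
proof -
  obtain L where L: "subring L R" "transc L x"
    and max: "\<And>L'. subring L' R \<Longrightarrow> transc L' x \<Longrightarrow> L \<subseteq> L' \<Longrightarrow> L' = L"
    using exists_maximal_transc[OF assms] by blast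
  have in_L: "y \<in> L" if "y \<in> carrier R" "transc (simple_extension L y) x" for y
    using max[OF simple_extension_is_subring[OF L(1) that(1)] that(2)]
      simple_extension_incl[OF subringE(1)[OF L(1)] that(1)] simple_extension_mem[OF L(1) that(1)] by auto
  have invs: "inv a \<in> L" if a: "a \<in> L" "a \<noteq> \<zero>" for a
  proof -
    have "a \<in> Units R" using a subringE(1)[OF L(1)] field_Units by auto
    then show ?thesis using in_L transc_adjoin_inverse[OF L(1) x L(2) a(1)] by auto
  qed
  have alg: "\<not> transc (simple_extension L x) y" if y: "y \<in> carrier R" for y
  proof
    assume t: "transc (simple_extension L x) y"
    then have "y \<in> L" using in_L[OF y] transc_exchange[OF L(1) x y L(2)] by blast
    then have "y \<in> simple_extension L x" using simple_extension_incl[OF subringE(1)[OF L(1)] x] by blast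
    moreover have "\<one> \<in> simple_extension (simple_extension L x) y" 
      using subringE(3)[OF simple_extension_is_subring[OF simple_extension_is_subring[OF L(1) x] y]] .
    ultimately have "y = \<zero>" using transcD[OF t, of y \<one>] y by simp
    then show False using t unfolding transc_def by blast
  qed
  show ?thesis using L invs alg by blast
qed

section \<open>Subrings maximal with respect to missing an inverse\<close>

lemma (in field) inv_simps:
  assumes "a \<in> carrier R" "a \<noteq> \<zero>"
  shows "inv a \<in> carrier R" "a \<otimes> inv a = \<one>" "inv a \<otimes> a = \<one>" "inv a \<noteq> \<zero>" "inv (inv a) = a"
proof -
  have u: "a \<in> Units R" using assms field_Units by blast
  show 1: "inv a \<in> carrier R" "a \<otimes> inv a = \<one>" "inv a \<otimes> a = \<one>" "inv (inv a) = a"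
    using u by simp_all
  show "inv a \<noteq> \<zero>" using 1(2) assms(1) by auto
qed

lemma (in ring) subring_pow: "subring B R \<Longrightarrow> b \<in> B \<Longrightarrow> b [^] (k::nat) \<in> B"
  by (induction k) (auto simp: subringE(3,6))

lemma (in ring) subring_minus: "subring B R \<Longrightarrow> b \<in> B \<Longrightarrow> c \<in> B \<Longrightarrow> b \<ominus> c \<in> B"
  by (simp add: a_minus_def subringE(5,7))

text \<open>An element \<open>v\<close> comaximal with \<open>q\<close> cannot help to invert \<open>q\<close>: from \<open>v + c q = 1\<close> one gets
\<open>v\<^sup>k / q = v\<^sup>k\<^sup>+\<^sup>1 / q + v\<^sup>k c\<close>, so the powers of \<open>v\<close> are removed one at a time. It is used once
with \<open>v\<close> congruent to \<open>1\<close> modulo \<open>q\<close> to show that \<open>v\<close> is a unit, and once for a coprime pair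
\<open>Q\<close>, \<open>1 - Q\<close>.\<close>
lemma (in field) comaximal_power_cancel:
  assumes B: "subring B R" and v: "v \<in> B" and q: "q \<in> B" "q \<noteq> \<zero>" and c: "c \<in> B"
    and one: "v \<oplus> c \<otimes> q = \<one>" and k: "v [^] (k::nat) \<otimes> inv q \<in> B"
  shows "inv q \<in> B"
  using k
proof (induction k)
  case 0
  have "q \<in> carrier R" using q subringE(1)[OF B] by auto
  then show ?case using 0 inv_simps q by simp
next
  case (Suc k)
  have car: "v \<in> carrier R" "q \<in> carrier R" "c \<in> carrier R" using v q c subringE(1)[OF B] by auto
  note iq = inv_simps[OF car(2) q(2)]
  have vk: "v [^] k \<in> B" "v [^] k \<in> carrier R" using subring_pow[OF B v] car by auto
  have "v [^] k \<otimes> inv q = v [^] k \<otimes> inv q \<otimes> (v \<oplus> c \<otimes> q)" using one vk iq by simp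
  also have "\<dots> = v [^] k \<otimes> v \<otimes> inv q \<oplus> v [^] k \<otimes> c \<otimes> (inv q \<otimes> q)"
    using car vk iq(1) by algebra
  also have "\<dots> = v [^] Suc k \<otimes> inv q \<oplus> v [^] k \<otimes> c" using iq car vk by simp
  also have "\<dots> \<in> B" using subringE(6,7)[OF B] Suc.prems vk c by blast
  finally show ?case by (rule Suc.IH)
qed

text \<open>Reversal of coefficients: \<open>y\<^sup>m f(1/y)\<close> is a polynomial in \<open>y\<close> of degree at most \<open>m\<close>.\<close>
lemma (in domain) poly_vals_reverse:
  assumes B: "subring B R" and y: "y \<in> carrier R" "z \<in> carrier R" "y \<otimes> z = \<one>"
  shows "w \<in> poly_vals B z (Suc m) \<Longrightarrow> y [^] m \<otimes> w \<in> poly_vals B y (Suc m)"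
proof (induction m arbitrary: w)
  interpret Y: poly_vals_over R B y using B y by (intro poly_vals_overI)
  interpret Z: poly_vals_over R B z using B y by (intro poly_vals_overI)
  {
    case 0
    then obtain b where "b \<in> B" "w = \<zero> \<otimes> z \<oplus> b" by (auto elim!: poly_vals_SucE)
    then show ?case using Y.const[of b 0] y Y.L_carr by simp
  next
    case (Suc m)
    obtain u b where u: "u \<in> poly_vals B z (Suc m)" "b \<in> B" "w = u \<otimes> z \<oplus> b"
      using Suc.prems by (rule poly_vals_SucE)
    have car: "u \<in> carrier R" "b \<in> carrier R" "y [^] m \<in> carrier R"
      using u Z.carr Z.L_carr y by auto
    have "y [^] Suc m \<otimes> w = (y [^] m \<otimes> u) \<otimes> (y \<otimes> z) \<oplus> b \<otimes> y [^] Suc m"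
      unfolding u(3) nat_pow_Suc using car y(1,2) by algebra
    then have "y [^] Suc m \<otimes> w = y [^] m \<otimes> u \<oplus> b \<otimes> y [^] Suc m"
      unfolding y(3) using car by simp
    moreover have "y [^] m \<otimes> u \<in> poly_vals B y (Suc (Suc m))"
      using Y.mono_Suc[OF Suc.IH[OF u(1)]] .
    moreover have "b \<otimes> y [^] Suc m \<in> poly_vals B y (Suc (Suc m))"
      using Y.lead_mem[OF u(2)] .
    ultimately show ?case using Y.add by simp
  }
qed

text \<open>A subring that is maximal among those not containing \<open>1/q\<close> has \<open>q\<close> in its Jacobson radical:
adjoining the inverse of \<open>v = 1 - c q\<close> cannot produce \<open>1/q\<close>, so that inverse is already present.\<close>
lemma (in field) unit_near_one:
  assumes B: "subring B R" and q: "q \<in> B" "q \<noteq> \<zero>" "inv q \<notin> B"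
    and max: "\<And>C. subring C R \<Longrightarrow> B \<subseteq> C \<Longrightarrow> C \<noteq> B \<Longrightarrow> inv q \<in> C"
    and c: "c \<in> B"
  shows "\<one> \<ominus> c \<otimes> q \<noteq> \<zero>" "inv (\<one> \<ominus> c \<otimes> q) \<in> B"
proof -
  let ?v = "\<one> \<ominus> c \<otimes> q"
  have car: "q \<in> carrier R" "c \<in> carrier R" using q c subringE(1)[OF B] by auto
  note iq = inv_simps[OF car(1) q(2)]
  have v: "?v \<in> B" using subring_minus[OF B subringE(3)[OF B] subringE(6)[OF B c q(1)]] .
  then have vc: "?v \<in> carrier R" using subringE(1)[OF B] by blast
  have one: "?v \<oplus> c \<otimes> q = \<one>" using car by algebra
  show nz: "?v \<noteq> \<zero>"
  proof
    assume "?v = \<zero>"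
    then have "c \<otimes> q = \<one>" using one car by simp
    then have "c = inv q" using car iq by (metis inv_char m_comm)
    then show False using c q by simp
  qed
  note iv = inv_simps[OF vc nz]
  show "inv ?v \<in> B"
  proof (rule ccontr)
    assume n: "inv ?v \<notin> B"
    let ?C = "simple_extension B (inv ?v)"
    have "inv ?v \<in> ?C" using simple_extension_mem[OF B iv(1)] .
    then have "inv q \<in> ?C"
      using max[OF simple_extension_is_subring[OF B iv(1)] simple_extension_incl[OF subringE(1)[OF B] iv(1)]] n
      by metis
    then obtain N where "?v [^] (N::nat) \<otimes> inv q \<in> B"
      using clear_denominator[OF B v iv(1,2)] by blast
    then show False using comaximal_power_cancel[OF B v q(1,2) c one] q(3) by blast
  qed
qed

text \<open>The descent in Chevalley's argument. Let \<open>1/q\<close> be a polynomial in \<open>y\<close> of degree at most \<open>n\<close> and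
a polynomial in \<open>z = 1/y\<close> of degree at most \<open>m \<le> n\<close>. Reversing the second expression gives
\<open>y\<^sup>m / q = c y\<^sup>m + \<dots>\<close>, and since \<open>1 - c q\<close> is a unit, \<open>y\<^sup>m / q\<close> has degree less than \<open>m\<close>. Its multiple
\<open>y\<^sup>n / q\<close> then has degree less than \<open>n\<close>, which removes the leading term of the first
expression.\<close>
lemma (in field) reduce_degree:
  assumes B: "subring B R" and q: "q \<in> B" "q \<noteq> \<zero>" "inv q \<notin> B"
    and max: "\<And>C. subring C R \<Longrightarrow> B \<subseteq> C \<Longrightarrow> C \<noteq> B \<Longrightarrow> inv q \<in> C"
    and yz: "y \<in> carrier R" "z \<in> carrier R" "y \<otimes> z = \<one>"
    and n: "inv q \<in> poly_vals B y (Suc n)" and m: "inv q \<in> poly_vals B z (Suc m)" and "m \<le> n"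
  shows "inv q \<in> poly_vals B y n"
proof -
  interpret Y: poly_vals_over R B y using B yz by (intro poly_vals_overI)
  have qc: "q \<in> carrier R" using Y.L_carr q(1) .
  note iq = inv_simps[OF qc q(2)]
  have ym: "y [^] m \<in> carrier R" "y [^] n \<in> carrier R" using yz by auto
  obtain c w where w: "c \<in> B" "w \<in> poly_vals B y m" "y [^] m \<otimes> inv q = c \<otimes> y [^] m \<oplus> w"
    using poly_vals_reverse[OF B yz m] by (rule Y.top_decomp)
  have car: "c \<in> carrier R" "w \<in> carrier R" using w Y.L_carr Y.carr by auto
  let ?v = "\<one> \<ominus> c \<otimes> q"
  have u: "?v \<noteq> \<zero>" "inv ?v \<in> B" using unit_near_one[OF B q max w(1)] by auto
  have vc: "?v \<in> carrier R" using car qc by simp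
  note iv = inv_simps[OF vc u(1)]
  have "y [^] m \<otimes> inv q \<otimes> ?v = y [^] m \<otimes> inv q \<ominus> c \<otimes> y [^] m \<otimes> (inv q \<otimes> q)"
    using car qc iq(1) ym by algebra
  also have "\<dots> = y [^] m \<otimes> inv q \<ominus> c \<otimes> y [^] m" using iq car ym by simp
  also have "\<dots> = w" unfolding w(3) using car ym by algebra
  finally have "y [^] m \<otimes> inv q \<otimes> (?v \<otimes> inv ?v) = inv ?v \<otimes> w"
    using vc iv(1) ym iq(1) car by (metis m_assoc m_closed m_comm)
  then have "y [^] m \<otimes> inv q = inv ?v \<otimes> w" using iv ym iq(1) by simp
  then have red: "y [^] m \<otimes> inv q \<in> poly_vals B y m" using Y.scale[OF u(2) w(2)] by simp
  have "y [^] n \<otimes> inv q = (y [^] m \<otimes> inv q) \<otimes> y [^] (n - m)"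
    using \<open>m \<le> n\<close> yz iq(1) nat_pow_mult[OF yz(1), of m "n - m"] nat_pow_closed[OF yz(1)]
    by (metis le_add_diff_inverse m_assoc m_comm)
  then have redn: "y [^] n \<otimes> inv q \<in> poly_vals B y n"
    using Y.shift_pow[OF red, of "n - m"] \<open>m \<le> n\<close> by simp
  obtain b v where v: "b \<in> B" "v \<in> poly_vals B y n" "inv q = b \<otimes> y [^] n \<oplus> v"
    using n by (rule Y.top_decomp)
  have bc: "b \<in> carrier R" using v Y.L_carr by auto
  have "b \<otimes> y [^] n = (b \<otimes> q) \<otimes> (y [^] n \<otimes> inv q)"
  proof -
    have "(b \<otimes> q) \<otimes> (y [^] n \<otimes> inv q) = b \<otimes> y [^] n \<otimes> (q \<otimes> inv q)"
      using bc qc ym iq(1) by algebra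
    then show ?thesis using iq bc ym by simp
  qed
  then have "b \<otimes> y [^] n \<in> poly_vals B y n"
    using Y.scale[OF subringE(6)[OF B v(1) q(1)] redn] by simp
  then show ?thesis using Y.add v(2,3) by simp
qed

text \<open>If both \<open>y\<close> and \<open>1/y\<close> were missing from \<open>B\<close>, then \<open>1/q\<close> would lie in \<open>B[y]\<close> and in \<open>B[1/y]\<close>.
Taking both expressions of least degree, the longer one can be shortened.\<close>
lemma (in field) maximal_excluding_valuation:
  assumes B: "subring B R" and q: "q \<in> B" "q \<noteq> \<zero>" "inv q \<notin> B"
    and max: "\<And>C. subring C R \<Longrightarrow> B \<subseteq> C \<Longrightarrow> C \<noteq> B \<Longrightarrow> inv q \<in> C"
    and y: "y \<in> carrier R" "y \<noteq> \<zero>"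
  shows "y \<in> B \<or> inv y \<in> B"
proof (rule ccontr)
  assume "\<not> ?thesis"
  then have n: "y \<notin> B" "inv y \<notin> B" by auto
  note iy = inv_simps[OF y]
  have qc: "q \<in> carrier R" using q(1) subringE(1)[OF B] by auto
  note iq = inv_simps[OF qc q(2)]
  have ex: "\<exists>n. inv q \<in> poly_vals B t n" if "t \<in> carrier R" "t \<notin> B" for t
  proof -
    interpret T: poly_vals_over R B t using B that(1) by (intro poly_vals_overI)
    have "inv q \<in> simple_extension B t"
      using max[OF simple_extension_is_subring[OF B that(1)] simple_extension_incl[OF subringE(1)[OF B] that(1)]]
        simple_extension_mem[OF B that(1)] that(2) by metis
    then show ?thesis using T.simple_extension_eq by auto
  qed
  define n where "n = (LEAST n. inv q \<in> poly_vals B y n)"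
  define m where "m = (LEAST m. inv q \<in> poly_vals B (inv y) m)"
  have nn: "inv q \<in> poly_vals B y n" "\<And>k. k < n \<Longrightarrow> inv q \<notin> poly_vals B y k"
    unfolding n_def using LeastI_ex[OF ex[OF y(1) n(1)]] not_less_Least by auto
  have mm: "inv q \<in> poly_vals B (inv y) m" "\<And>k. k < m \<Longrightarrow> inv q \<notin> poly_vals B (inv y) k"
    unfolding m_def using LeastI_ex[OF ex[OF iy(1) n(2)]] not_less_Least by auto
  obtain n' where n': "n = Suc n'" using nn(1) iq(4) by (cases n) auto
  obtain m' where m': "m = Suc m'" using mm(1) iq(4) by (cases m) auto
  show False
  proof (cases "m' \<le> n'")
    case True
    then show False
      using reduce_degree[OF B q max y(1) iy(1,2) _ _ True] nn mm n' m' by auto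
  next
    case False
    then have "n' \<le> m'" by simp
    then show False
      using reduce_degree[OF B q max iy(1) y(1) iy(3) _ _ \<open>n' \<le> m'\<close>] nn mm n' m' by auto
  qed
qed

lemma (in field) exists_maximal_excluding:
  assumes D: "subring D R" and u: "u \<notin> D"
  shows "\<exists>B. subring B R \<and> D \<subseteq> B \<and> u \<notin> B \<and>
    (\<forall>C. subring C R \<longrightarrow> B \<subseteq> C \<longrightarrow> C \<noteq> B \<longrightarrow> u \<in> C)"
proof -
  let ?A = "{B. subring B R \<and> D \<subseteq> B \<and> u \<notin> B}"
  have "\<exists>M\<in>?A. \<forall>S\<in>?A. M \<subseteq> S \<longrightarrow> S = M"
  proof (rule subset_Zorn_nonempty)
    show "?A \<noteq> {}" using assms by blast
    fix C assume C: "C \<noteq> {}" "subset.chain ?A C"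
    then have chain: "S \<in> C \<Longrightarrow> T \<in> C \<Longrightarrow> S \<subseteq> T \<or> T \<subseteq> S" and mem: "S \<in> C \<Longrightarrow> S \<in> ?A" for S T
      unfolding subset.chain_def by auto
    have "subring (\<Union>C) R"
      by (rule subring_Union_chain[OF C(1)]) (use mem chain in auto)
    moreover have "D \<subseteq> \<Union>C" "u \<notin> \<Union>C" using C(1) mem by auto
    ultimately show "\<Union>C \<in> ?A" by blast
  qed
  then obtain B where B: "B \<in> ?A" "\<forall>S\<in>?A. B \<subseteq> S \<longrightarrow> S = B" by (rule bexE)
  have "u \<in> C" if "subring C R" "B \<subseteq> C" "C \<noteq> B" for C
    using B that by blast
  then show ?thesis using B(1) by blast
qed

text \<open>Euclidean division by \<open>p\<close>, with leading coefficient \<open>a\<close> and degree \<open>n\<close>. The bound \<open>k - n\<close> on the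
quotient makes it a proper descent when \<open>n > 0\<close>.\<close>
lemma (in field) poly_vals_divide:
  assumes L: "subring L R" "\<And>a. a \<in> L \<Longrightarrow> a \<noteq> \<zero> \<Longrightarrow> inv a \<in> L" and x: "x \<in> carrier R"
    and p: "a \<in> L" "a \<noteq> \<zero>" "w \<in> poly_vals L x n" "p = a \<otimes> x [^] n \<oplus> w"
  shows "g \<in> poly_vals L x k \<Longrightarrow>
    \<exists>s\<in>poly_vals L x (k - n). \<exists>r\<in>poly_vals L x n. g = p \<otimes> s \<oplus> r"
proof (induction k arbitrary: g)
  interpret W: poly_vals_over R L x using L x by (intro poly_vals_overI)
  have pw: "p \<in> poly_vals L x (Suc n)"
    unfolding p(4) using W.add[OF W.lead_mem[OF p(1)] W.mono_Suc[OF p(3)]] .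
  have pc: "p \<in> carrier R" using W.carr pw .
  {
    case 0
    then show ?case using W.zero[of n] pc by (auto intro!: bexI[of _ \<zero>])
  next
    case (Suc k)
    show ?case
    proof (cases "Suc k \<le> n")
      case True
      then show ?thesis using W.mono[OF Suc.prems True] W.zero[of "Suc k - n"] W.carr[OF Suc.prems] pc
        by (intro bexI[of _ \<zero>] bexI[of _ g]) auto
    next
      case False
      then obtain j where j: "k = n + j" using less_eqE by (metis Suc_leI linorder_not_le not_less_eq)
      obtain b v where v: "b \<in> L" "v \<in> poly_vals L x k" "g = b \<otimes> x [^] k \<oplus> v"
        using Suc.prems by (rule W.top_decomp)
      have ac: "a \<in> carrier R" using W.L_carr p(1) .
      note ia = inv_simps[OF ac p(2)]
      let ?e = "b \<otimes> inv a"
      have eL: "?e \<in> L" using subringE(6)[OF L(1) v(1) L(2)[OF p(1,2)]] .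
      let ?h = "v \<ominus> ?e \<otimes> (w \<otimes> x [^] j)"
      have "w \<otimes> x [^] j \<in> poly_vals L x k" using W.shift_pow[OF p(3)] j by simp
      then have "?h \<in> poly_vals L x k" using W.minus[OF v(2) W.scale[OF eL]] by blast
      from Suc.IH[OF this] obtain s r where
        sr: "s \<in> poly_vals L x (k - n)" "r \<in> poly_vals L x n" "?h = p \<otimes> s \<oplus> r" by blast
      have car: "b \<in> carrier R" "v \<in> carrier R" "w \<in> carrier R" "x [^] j \<in> carrier R" "x [^] n \<in> carrier R"
         "s \<in> carrier R" "r \<in> carrier R" "?e \<in> carrier R"
        using v p W.carr W.L_carr x sr eL by auto
      have "b = ?e \<otimes> a"
      proof -
        have "?e \<otimes> a = b \<otimes> (inv a \<otimes> a)" using car ac ia(1) by (simp add: m_assoc)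
        then show ?thesis using ia car by simp
      qed
      then have "g = ?e \<otimes> a \<otimes> (x [^] n \<otimes> x [^] j) \<oplus> v"
        using v(3) nat_pow_mult[OF x, of n j] j by simp
      also have "\<dots> = p \<otimes> (?e \<otimes> x [^] j) \<oplus> ?h"
        unfolding p(4) using car ac ia(1) by algebra
      also have "\<dots> = p \<otimes> (?e \<otimes> x [^] j \<oplus> s) \<oplus> r"
        unfolding sr(3) using car pc by algebra
      finally have "g = p \<otimes> (?e \<otimes> x [^] j \<oplus> s) \<oplus> r" .
      moreover have "?e \<otimes> x [^] j \<oplus> s \<in> poly_vals L x (Suc k - n)"
        using W.add[OF W.lead_mem[OF eL, of j] W.mono_Suc] sr(1) j by (simp add: Suc_diff_le)
      ultimately show ?thesis using sr(2) by blast
    qed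
  }
qed


section \<open>Maximal subrings of a field with a transcendental element\<close>

text \<open>Let \<open>B\<close> be maximal among the subrings that contain \<open>D = L[x]\<close> but not \<open>1/q\<close>; it is a valuation
ring, so its nonunits form an ideal. That \<open>B\<close> is a maximal subring, that is, of rank one, comes
from \<open>D\<close> being Euclidean. Let \<open>p\<close> be a nonunit of \<open>B\<close> in \<open>D\<close> of least degree. A nonzero remainder
modulo \<open>p\<close> is a unit of \<open>B\<close>, so \<open>p\<close> divides in \<open>D\<close> every element of \<open>D\<close> that is a nonunit of \<open>B\<close>;
repeating this, every nonzero element of \<open>D\<close> is a power of \<open>p\<close> times a unit of \<open>B\<close>. A subring \<open>C\<close>
properly above \<open>B\<close> contains \<open>1/q\<close>, hence \<open>1/p\<close>, hence all inverses of nonzero elements of \<open>D\<close>. An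
element \<open>y\<close> outside \<open>B\<close> has \<open>1/y\<close> in \<open>B\<close>, and as \<open>1/y\<close> is algebraic over \<open>D\<close> it divides in \<open>B\<close>
some nonzero \<open>b\<close> in \<open>D\<close>; so \<open>y\<close> is in \<open>C\<close> as well, because \<open>1/b\<close> is.\<close>
lemma (in field) exists_maximal_subring_without_inverse:
  assumes L: "subring L R" "\<And>a. a \<in> L \<Longrightarrow> a \<noteq> \<zero> \<Longrightarrow> inv a \<in> L"
    and x: "x \<in> carrier R" and tr: "transc L x"
    and alg: "\<And>y. y \<in> carrier R \<Longrightarrow> \<not> transc (simple_extension L x) y"
    and q: "q \<in> simple_extension L x" "q \<notin> L"
  shows "\<exists>B. maximal_subring B R \<and> simple_extension L x \<subseteq> B \<and> inv q \<notin> B"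
proof -
  interpret W: poly_vals_over R L x using L x by (intro poly_vals_overI)
  let ?D = "simple_extension L x"
  have D: "subring ?D R" using simple_extension_is_subring[OF L(1) x] .
  have LD: "L \<subseteq> ?D" using simple_extension_incl[OF subringE(1)[OF L(1)] x] .
  have Dc: "g \<in> ?D \<Longrightarrow> g \<in> carrier R" for g using subringE(1)[OF D] by blast
  have q0: "q \<noteq> \<zero>" using q(2) subringE(2)[OF L(1)] by auto
  note iq = inv_simps[OF Dc[OF q(1)] q0]
  have "inv q \<notin> ?D" using simple_extension_units[OF L(1) x tr q(1) _ iq(2)] q(2) by blast
  then obtain B where B: "subring B R" "?D \<subseteq> B" "inv q \<notin> B"
    and Bmax: "\<And>C. subring C R \<Longrightarrow> B \<subseteq> C \<Longrightarrow> C \<noteq> B \<Longrightarrow> inv q \<in> C"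
    using exists_maximal_excluding[OF D] by metis
  have Bc: "b \<in> B \<Longrightarrow> b \<in> carrier R" for b using subringE(1)[OF B(1)] by blast
  have qB: "q \<in> B" using q(1) B(2) by blast
  have val: "y \<in> B \<or> inv y \<in> B" if "y \<in> carrier R" "y \<noteq> \<zero>" for y
    using maximal_excluding_valuation[OF B(1) qB q0 B(3) Bmax that] .
  \<comment> \<open>of two nonzero nonunits one divides the other, and a sum of the form \<open>a (1 + b/a)\<close> inherits
    non-invertibility from \<open>a\<close>\<close>
  have nonunit_add: "inv (a \<oplus> b) \<notin> B"
    if "a \<in> B" "a \<noteq> \<zero>" "inv a \<notin> B" "b \<in> B" "b = \<zero> \<or> inv b \<notin> B" "a \<oplus> b \<noteq> \<zero>" for a b
  proof (cases "b = \<zero>")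
    case True
    then show ?thesis using that Bc by simp
  next
    case False
    have key: "inv (a \<oplus> b) \<notin> B"
      if a: "a \<in> B" "a \<noteq> \<zero>" "inv a \<notin> B" and b: "b \<in> B" "b \<otimes> inv a \<in> B" and ab: "a \<oplus> b \<noteq> \<zero>" for a b
    proof
      assume i: "inv (a \<oplus> b) \<in> B"
      have c: "a \<in> carrier R" "b \<in> carrier R" "a \<oplus> b \<in> carrier R" using a b Bc by auto
      note ia = inv_simps[OF c(1) a(2)] and iab = inv_simps[OF c(3) ab]
      have "(\<one> \<oplus> b \<otimes> inv a) \<otimes> inv (a \<oplus> b) = (a \<otimes> inv a \<oplus> b \<otimes> inv a) \<otimes> inv (a \<oplus> b)"
        using ia by simp
      also have "\<dots> = inv a \<otimes> ((a \<oplus> b) \<otimes> inv (a \<oplus> b))" using c(1,2) ia(1) iab(1) by algebra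
      also have "\<dots> = inv a" using ia iab by simp
      finally have "inv a \<in> B" 
        using subringE(6)[OF B(1) subringE(7)[OF B(1) subringE(3)[OF B(1)] b(2)] i] by simp
      then show False using a by blast
    qed
    have c: "a \<in> carrier R" "b \<in> carrier R" using that Bc by auto
    note ia = inv_simps[OF c(1) \<open>a \<noteq> \<zero>\<close>] and ib = inv_simps[OF c(2) False]
    have nz: "b \<otimes> inv a \<noteq> \<zero>" using integral c ia(1,4) False by blast
    have "(b \<otimes> inv a) \<otimes> (a \<otimes> inv b) = (b \<otimes> inv b) \<otimes> (inv a \<otimes> a)"
      using c ia(1) ib(1) by algebra
    then have "(b \<otimes> inv a) \<otimes> (a \<otimes> inv b) = \<one>" using ia ib by simp
    then have "inv (b \<otimes> inv a) = a \<otimes> inv b"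
      using c ia(1) ib(1) by (metis inv_char m_closed m_comm)
    then consider "b \<otimes> inv a \<in> B" | "a \<otimes> inv b \<in> B" using val[of "b \<otimes> inv a"] nz c ia(1) by auto
    then show ?thesis
    proof cases
      case 1
      then show ?thesis using key that by blast
    next
      case 2
      then show ?thesis using key[of b a] that False c by (simp add: a_comm)
    qed
  qed
  define nonunit where "nonunit g \<longleftrightarrow> g \<noteq> \<zero> \<and> inv g \<notin> B" for g
  define k where "k = (LEAST k. \<exists>g\<in>poly_vals L x k. nonunit g)"
  have "\<exists>k. \<exists>g\<in>poly_vals L x k. nonunit g"
    using q(1) q0 B(3) unfolding W.simple_extension_eq nonunit_def by blast
  then have "\<exists>g\<in>poly_vals L x k. nonunit g" unfolding k_def by (rule LeastI_ex)
  then obtain p where p: "p \<in> poly_vals L x k" "nonunit p" by blast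
  have least: "\<not> nonunit g" if "g \<in> poly_vals L x j" "j < k" for g j
    using not_less_Least[of j "\<lambda>k. \<exists>g\<in>poly_vals L x k. nonunit g"] that unfolding k_def by blast
  obtain n where n: "k = Suc n" using p unfolding nonunit_def by (cases k) auto
  obtain a w where aw: "a \<in> L" "w \<in> poly_vals L x n" "p = a \<otimes> x [^] n \<oplus> w"
    using p(1) unfolding n by (rule W.top_decomp)
  have a0: "a \<noteq> \<zero>"
  proof
    assume "a = \<zero>"
    then have "p = w" using aw W.carr x by simp
    then show False using least[OF aw(2)] p(2) n by simp
  qed
  \<comment> \<open>the nonzero constants have their inverses in \<open>L\<close>, hence in \<open>B\<close>\<close>
  have n0: "n \<noteq> 0"
  proof
    assume "n = 0"
    then have "p = a" using aw x W.L_carr by simp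
    then show False using L(2)[OF aw(1) a0] p(2) LD B(2) unfolding nonunit_def by blast
  qed
  have pD: "p \<in> ?D" using W.simple_extensionI p(1) .
  have pB: "p \<in> B" "p \<noteq> \<zero>" "inv p \<notin> B" using pD B(2) p(2) unfolding nonunit_def by auto
  note ip = inv_simps[OF Bc[OF pB(1)] pB(2)]
  have divides: "\<exists>s\<in>poly_vals L x (j - n). g = p \<otimes> s" if g: "g \<in> poly_vals L x j" "nonunit g" for g j
  proof -
    obtain s r where sr: "s \<in> poly_vals L x (j - n)" "r \<in> poly_vals L x n" "g = p \<otimes> s \<oplus> r"
      using poly_vals_divide[OF L x aw(1) a0 aw(2,3) g(1)] by blast
    have c: "s \<in> carrier R" "r \<in> carrier R" "p \<in> carrier R" "g \<in> carrier R"
      using sr g W.carr p(1) by auto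
    have sB: "s \<in> B" "g \<in> B" using W.simple_extensionI sr(1) g(1) B(2) by auto
    have g0: "g \<noteq> \<zero>" "inv g \<notin> B" using g(2) unfolding nonunit_def by auto
    have "r = \<zero>"
    proof (rule ccontr)
      assume r0: "r \<noteq> \<zero>"
      have r: "r = g \<oplus> \<ominus> (p \<otimes> s)" unfolding sr(3) using c by algebra
      have psB: "\<ominus> (p \<otimes> s) \<in> B" using subringE(5,6)[OF B(1)] pB(1) sB(1) by blast
      have "\<ominus> (p \<otimes> s) = \<zero> \<or> inv (\<ominus> (p \<otimes> s)) \<notin> B"
      proof (rule disjCI)
        let ?t = "\<ominus> (p \<otimes> s)"
        assume "\<not> inv ?t \<notin> B"
        then have iB: "inv ?t \<in> B" by blast
        show "?t = \<zero>"
        proof (rule ccontr)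
          assume t0: "?t \<noteq> \<zero>"
          have tc: "?t \<in> carrier R" using c by simp
          note it = inv_simps[OF tc t0]
          have "p \<otimes> (\<ominus> s \<otimes> inv ?t) = ?t \<otimes> inv ?t" using c(1,3) it(1) by algebra
          then have "p \<otimes> (\<ominus> s \<otimes> inv ?t) = \<one>" using it by simp
          then have "inv p = \<ominus> s \<otimes> inv ?t"
            using c it(1) by (metis a_inv_closed inv_char m_closed m_comm)
          then show False using subringE(6)[OF B(1) subringE(5)[OF B(1) sB(1)] iB] pB(3) by simp
        qed
      qed
      then have "inv r \<notin> B" unfolding r using nonunit_add[OF sB(2) g0 psB] r0 r by simp
      then show False using least[OF sr(2)] n r0 unfolding nonunit_def by blast
    qed
    then have "g = p \<otimes> s" using sr(3) c by simp
    then show ?thesis using sr(1) by blast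
  qed
  have power: "\<exists>i::nat. \<exists>u\<in>B. inv g = u \<otimes> (inv p) [^] i"
    if "g \<in> poly_vals L x j" "g \<noteq> \<zero>" for g j
    using that
  proof (induction j arbitrary: g rule: less_induct)
    case (less j)
    have gc: "g \<in> carrier R" using W.carr less.prems(1) .
    note ig = inv_simps[OF gc less.prems(2)]
    show ?case
    proof (cases "nonunit g")
      case False
      then have "inv g \<in> B" using less.prems(2) unfolding nonunit_def by blast
      then show ?thesis using ig ip by (intro exI[of _ 0] bexI[of _ "inv g"]) auto
    next
      case True
      obtain s where s: "s \<in> poly_vals L x (j - n)" "g = p \<otimes> s" using divides[OF less.prems(1) True] by blast
      have sc: "s \<in> carrier R" using W.carr s(1) .
      have s0: "s \<noteq> \<zero>" using s(2) less.prems(2) Bc[OF pB(1)] by auto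
      note inv_s = inv_simps[OF sc s0]
      have "j \<noteq> 0" using less.prems by (cases j) auto
      then have "j - n < j" using n0 by simp
      then obtain i u where u: "u \<in> B" "inv s = u \<otimes> (inv p) [^] (i::nat)"
        using less.IH[OF _ s(1) s0] by blast
      have "g \<otimes> (inv s \<otimes> inv p) = (s \<otimes> inv s) \<otimes> (p \<otimes> inv p)"
        unfolding s(2) using sc Bc[OF pB(1)] inv_s(1) ip(1) by algebra
      then have "g \<otimes> (inv s \<otimes> inv p) = \<one>" using inv_s ip by simp
      then have "inv g = inv s \<otimes> inv p"
        using gc inv_s(1) ip(1) by (metis inv_char m_closed m_comm)
      also have "\<dots> = u \<otimes> (inv p) [^] (Suc i)"
        unfolding u(2) using Bc[OF u(1)] ip(1) by (simp add: m_assoc)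
      finally show ?thesis using u(1) by blast
    qed
  qed
  have "C = carrier R" if C: "subring C R" "B \<subseteq> C" "C \<noteq> B" for C
  proof
    show "C \<subseteq> carrier R" using subringE(1)[OF C(1)] .
    have "nonunit q" using q0 B(3) unfolding nonunit_def by blast
    moreover obtain j where "q \<in> poly_vals L x j" using q(1) unfolding W.simple_extension_eq by blast
    ultimately obtain s j where s: "s \<in> poly_vals L x j" "q = p \<otimes> s" using divides by blast
    have sc: "s \<in> carrier R" using W.carr s(1) .
    have "p \<otimes> (s \<otimes> inv q) = q \<otimes> inv q" unfolding s(2)
      using Bc[OF pB(1)] sc iq(1) s(2) by (simp add: m_assoc)
    then have "p \<otimes> (s \<otimes> inv q) = \<one>" using iq by simp
    then have "inv p = s \<otimes> inv q"
      using Bc[OF pB(1)] sc iq(1) by (metis inv_char m_closed m_comm)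
    moreover have "s \<in> C" using W.simple_extensionI[OF s(1)] B(2) C(2) by blast
    ultimately have ipC: "inv p \<in> C" using subringE(6)[OF C(1)] Bmax[OF C] by simp
    show "carrier R \<subseteq> C"
    proof
      fix y assume y: "y \<in> carrier R"
      show "y \<in> C"
      proof (cases "y \<in> B")
        case True
        then show ?thesis using C(2) by blast
      next
        case False
        then have y0: "y \<noteq> \<zero>" using subringE(2)[OF B(1)] by blast
        note iy = inv_simps[OF y y0]
        have iyB: "inv y \<in> B" using val[OF y y0] False by blast
        obtain b v where b: "b \<in> ?D" "v \<in> simple_extension ?D (inv y)" "b = v \<otimes> inv y" "b \<noteq> \<zero>"
          using alg[OF iy(1)] iy(4) unfolding transc_def by blast
        have vB: "v \<in> B" using simple_extension_subring_incl[OF B(1,2) iyB] b(2) by blast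
        have bc: "b \<in> carrier R" using Dc b(1) .
        note ib = inv_simps[OF bc b(4)]
        obtain j where "b \<in> poly_vals L x j" using b(1) unfolding W.simple_extension_eq by blast
        then obtain u i where u: "u \<in> B" "inv b = u \<otimes> (inv p) [^] (i::nat)" using power b(4) by blast
        have "inv b \<in> C" unfolding u(2)
          using subringE(6)[OF C(1)] subring_pow[OF C(1) ipC] u(1) C(2) by blast
        moreover have "y = v \<otimes> inv b"
        proof -
          have "v \<otimes> inv b = (v \<otimes> inv y) \<otimes> inv b \<otimes> y"
          proof -
            have "(v \<otimes> inv y) \<otimes> inv b \<otimes> y = v \<otimes> inv b \<otimes> (inv y \<otimes> y)"
              using Bc[OF vB] iy(1) ib(1) y by algebra
            then show ?thesis using iy Bc[OF vB] ib(1) by simp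
          qed
          also have "\<dots> = y" unfolding b(3)[symmetric] using ib y by simp
          finally show ?thesis by simp
        qed
        ultimately show ?thesis using subringE(6)[OF C(1)] vB C(2) by blast
      qed
    qed
  qed
  then have "maximal_subring B R"
    using B(1,3) iq(1) unfolding maximal_subring_def by blast
  then show ?thesis using B(2,3) by blast
qed

text \<open>Euclid's argument for the infinitude of primes. If the field had only finitely many maximal
subrings, a product \<open>Q\<close> of nonconstant elements of \<open>L[x]\<close> would be a nonunit in each of those that
contain \<open>L[x]\<close> and miss the inverse of some nonconstant element. A maximal subring that contains
\<open>L[x]\<close> and misses \<open>1/(1 - Q)\<close> is one of them, so it misses \<open>1/Q\<close> too. But adjoining \<open>1/Q\<close> to it yields
everything, in particular \<open>1/(1 - Q)\<close>, and as \<open>Q\<close> and \<open>1 - Q\<close> are comaximal, \<open>1/(1 - Q)\<close> was there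
already.\<close>
lemma (in field) infinite_RgMax_if_transc:
  assumes x: "x \<in> carrier R" and L0: "subring L0 R" "transc L0 x"
  shows "infinite (RgMax R)"
proof
  assume fin: "finite (RgMax R)"
  obtain L where L: "subring L R" "\<And>a. a \<in> L \<Longrightarrow> a \<noteq> \<zero> \<Longrightarrow> inv a \<in> L" and tr: "transc L x"
    and alg: "\<And>y. y \<in> carrier R \<Longrightarrow> \<not> transc (simple_extension L x) y"
    using transcendence_complement[OF assms] by metis
  let ?D = "simple_extension L x"
  have D: "subring ?D R" using simple_extension_is_subring[OF L(1) x] .
  have LD: "L \<subseteq> ?D" using simple_extension_incl[OF subringE(1)[OF L(1)] x] .
  have Dc: "g \<in> ?D \<Longrightarrow> g \<in> carrier R" for g using subringE(1)[OF D] by blast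
  have nz: "g \<notin> L \<Longrightarrow> g \<noteq> \<zero>" for g using subringE(2)[OF L(1)] by blast
  have xL: "x \<notin> L"
  proof
    assume "x \<in> L"
    moreover have "\<one> \<in> ?D" using subringE(3)[OF D] .
    ultimately have "x = \<zero>" using transcD[OF tr, of x \<one>] x by simp
    then show False using tr unfolding transc_def by blast
  qed
  let ?M = "{M \<in> RgMax R. ?D \<subseteq> M \<and> (\<exists>q\<in>?D - L. inv q \<notin> M)}"
  have "\<exists>Q\<in>?D - L. \<forall>M\<in>F. inv Q \<notin> M" if "finite F" "F \<subseteq> ?M" for F
    using that
  proof (induction F rule: finite_induct)
    case empty
    then show ?case using simple_extension_mem[OF L(1) x] xL by blast
  next
    case (insert M F)
    then obtain Q where Q: "Q \<in> ?D" "Q \<notin> L" "\<forall>M\<in>F. inv Q \<notin> M" by blast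
    obtain q where q: "q \<in> ?D" "q \<notin> L" "inv q \<notin> M" using insert.prems by blast
    have c: "Q \<in> carrier R" "q \<in> carrier R" using Q q Dc by auto
    note iQ = inv_simps[OF c(1) nz[OF Q(2)]] and iq = inv_simps[OF c(2) nz[OF q(2)]]
    have P0: "Q \<otimes> q \<noteq> \<zero>" using integral c nz Q(2) q(2) by blast
    have Pc: "Q \<otimes> q \<in> carrier R" using c by simp
    note iP = inv_simps[OF Pc P0]
    have fac: "inv Q = q \<otimes> inv (Q \<otimes> q)" "inv q = Q \<otimes> inv (Q \<otimes> q)"
    proof -
      have "Q \<otimes> (q \<otimes> inv (Q \<otimes> q)) = \<one>" "q \<otimes> (Q \<otimes> inv (Q \<otimes> q)) = \<one>"
        using iP c by (simp_all add: m_assoc[symmetric] m_comm)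
      then show "inv Q = q \<otimes> inv (Q \<otimes> q)" "inv q = Q \<otimes> inv (Q \<otimes> q)"
        using c iP(1) by (metis inv_char m_closed m_comm)+
    qed
    have "Q \<otimes> q \<in> ?D" using subringE(6)[OF D] Q(1) q(1) by blast
    moreover have "Q \<otimes> q \<notin> L"
    proof
      assume "Q \<otimes> q \<in> L"
      then have "inv (Q \<otimes> q) \<in> ?D" using L(2) P0 LD by blast
      then have "inv Q \<in> ?D" unfolding fac(1) using subringE(6)[OF D] q(1) by blast
      then show False using simple_extension_units[OF L(1) x tr Q(1) _ iQ(2)] Q(2) by blast
    qed
    moreover have "inv (Q \<otimes> q) \<notin> N" if "N \<in> insert M F" for N
    proof
      assume i: "inv (Q \<otimes> q) \<in> N"
      have N: "N \<in> ?M" using that insert.prems by blast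
      then have NS: "subring N R" "?D \<subseteq> N" unfolding RgMax_def maximal_subring_def by auto
      have "inv Q \<in> N" "inv q \<in> N" unfolding fac
        using subringE(6)[OF NS(1)] NS(2) i Q(1) q(1) by blast+
      then show False using that Q(3) q(3) by blast
    qed
    ultimately show ?case by blast
  qed
  from this[of ?M] obtain Q where Q: "Q \<in> ?D" "Q \<notin> L" "\<And>M. M \<in> ?M \<Longrightarrow> inv Q \<notin> M"
    using fin by auto
  let ?q = "\<one> \<ominus> Q"
  have Qc: "Q \<in> carrier R" using Q(1) Dc by blast
  have qD: "?q \<in> ?D" using subring_minus[OF D subringE(3)[OF D] Q(1)] .
  have Qq: "Q = \<one> \<ominus> ?q" using Qc by algebra
  have qL: "?q \<notin> L" using subring_minus[OF L(1) subringE(3)[OF L(1)], of ?q] Q(2) Qq by auto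
  obtain B where B: "maximal_subring B R" "?D \<subseteq> B" "inv ?q \<notin> B"
    using exists_maximal_subring_without_inverse[OF L x tr alg qD qL] by blast
  then have "B \<in> ?M" using qD qL unfolding RgMax_def by blast
  then have iQB: "inv Q \<notin> B" by (rule Q(3))
  have BS: "subring B R" using B(1) unfolding maximal_subring_def by blast
  note iQ = inv_simps[OF Qc nz[OF Q(2)]]
  let ?C = "simple_extension B (inv Q)"
  have "?C = carrier R"
  proof (rule ccontr)
    assume "?C \<noteq> carrier R"
    then have "?C = B"
      using B(1) simple_extension_is_subring[OF BS iQ(1)] simple_extension_incl[OF subringE(1)[OF BS] iQ(1)]
      unfolding maximal_subring_def by blast
    then show False using simple_extension_mem[OF BS iQ(1)] iQB by simp
  qed
  moreover have "inv ?q \<in> carrier R" using inv_simps(1)[OF Dc[OF qD] nz[OF qL]] .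
  ultimately have "inv ?q \<in> ?C" by simp
  then obtain N where N: "Q [^] (N::nat) \<otimes> inv ?q \<in> B"
    using clear_denominator[OF BS _ iQ(1,2)] Q(1) B(2) by blast
  have "Q \<oplus> ?q = \<one>" using Qc a_lcomm[of Q \<one> "\<ominus> Q"] by (simp add: a_minus_def r_neg)
  then have "Q \<oplus> \<one> \<otimes> ?q = \<one>" using Qc by simp
  then have "inv ?q \<in> B"
    using comaximal_power_cancel[OF BS _ _ nz[OF qL] subringE(3)[OF BS] _ N] Q(1) qD B(2) by blast
  then show False using B(3) by blast
qed

section \<open>Derivations\<close>

definition (in ring) derivation :: "('a \<Rightarrow> 'a) \<Rightarrow> bool" where
  "derivation d \<longleftrightarrow> d \<in> carrier R \<rightarrow> carrier R \<and>
    (\<forall>a\<in>carrier R. \<forall>b\<in>carrier R. d (a \<oplus> b) = d a \<oplus> d b \<and> d (a \<otimes> b) = d a \<otimes> b \<oplus> a \<otimes> d b)"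

context cring
begin

context
  fixes d assumes d: "derivation d"
begin

lemma derivation_closed [simp]: "a \<in> carrier R \<Longrightarrow> d a \<in> carrier R"
  using d unfolding derivation_def by auto

lemma derivation_add: "a \<in> carrier R \<Longrightarrow> b \<in> carrier R \<Longrightarrow> d (a \<oplus> b) = d a \<oplus> d b"
  using d unfolding derivation_def by auto

lemma derivation_mult:
  "a \<in> carrier R \<Longrightarrow> b \<in> carrier R \<Longrightarrow> d (a \<otimes> b) = d a \<otimes> b \<oplus> a \<otimes> d b"
  using d unfolding derivation_def by auto

lemma derivation_zero: "d \<zero> = \<zero>"
  using derivation_add[of \<zero> \<zero>] derivation_closed[of \<zero>]
  by (metis add.l_cancel_one' l_zero zero_closed)

lemma derivation_one: "d \<one> = \<zero>"
  using derivation_mult[of \<one> \<one>] derivation_closed[of \<one>]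
  by (metis add.l_cancel_one' l_one one_closed r_one)

lemma derivation_uminus:
  assumes "a \<in> carrier R" shows "d (\<ominus> a) = \<ominus> d a"
proof -
  have "d (\<ominus> a) \<oplus> d a = \<zero>"
    using derivation_add[of "\<ominus> a" a] assms derivation_zero by (simp add: l_neg)
  then show ?thesis using assms by (simp add: minus_equality)
qed

lemma derivation_pow:
  assumes "x \<in> carrier R"
  shows "d (x [^] Suc n) = [Suc n] \<cdot> \<one> \<otimes> (x [^] n \<otimes> d x)"
proof (induction n)
  case 0
  then show ?case using assms by simp
next
  case (Suc n)
  have c: "x [^] n \<in> carrier R" "d x \<in> carrier R" "[Suc n] \<cdot> \<one> \<in> carrier R" using assms by auto
  have "d (x [^] Suc (Suc n)) = d (x [^] Suc n) \<otimes> x \<oplus> x [^] Suc n \<otimes> d x"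
    using derivation_mult[of "x [^] Suc n" x] assms by simp
  also have "\<dots> = [Suc n] \<cdot> \<one> \<otimes> (x [^] n \<otimes> d x) \<otimes> x \<oplus> x [^] n \<otimes> x \<otimes> d x"
    unfolding Suc by simp
  also have "\<dots> = ([Suc n] \<cdot> \<one> \<oplus> \<one>) \<otimes> (x [^] n \<otimes> x \<otimes> d x)"
    using c assms by algebra
  finally show ?case by simp
qed

lemma constants_subring: "subring {c \<in> carrier R. d c = \<zero>} R"
  by (rule subringI)
    (auto simp: derivation_add derivation_mult derivation_one derivation_uminus)

text \<open>Formal differentiation of a polynomial whose coefficients are killed by \<open>d\<close> lowers the degree and
pulls out the factor \<open>d x\<close>.\<close>
lemma derivation_poly_vals:
  assumes x: "x \<in> carrier R"
  defines "L \<equiv> {c \<in> carrier R. d c = \<zero>}"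
  shows "w \<in> poly_vals L x (Suc n) \<Longrightarrow> \<exists>v\<in>poly_vals L x n. d w = v \<otimes> d x"
proof (induction n arbitrary: w)
  have L: "subring L R" unfolding L_def by (rule constants_subring)
  interpret W: poly_vals_over R L x using L x by (intro poly_vals_overI)
  {
    case 0
    obtain u b where "u \<in> poly_vals L x 0" "b \<in> L" "w = u \<otimes> x \<oplus> b"
      using 0 by (rule poly_vals_SucE)
    then have "w = b" "d b = \<zero>" using x unfolding L_def by auto
    then show ?case using x by simp
  next
    case (Suc n)
    obtain u b where u: "u \<in> poly_vals L x (Suc n)" "b \<in> L" "w = u \<otimes> x \<oplus> b"
      using Suc.prems by (rule poly_vals_SucE)
    obtain v where v: "v \<in> poly_vals L x n" "d u = v \<otimes> d x" using Suc.IH[OF u(1)] by blast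
    have c: "u \<in> carrier R" "v \<in> carrier R" "b \<in> carrier R" "d b = \<zero>"
      using u v W.carr unfolding L_def by auto
    have "d w = d u \<otimes> x \<oplus> u \<otimes> d x"
      unfolding u(3) using c x by (simp add: derivation_add derivation_mult)
    also have "\<dots> = (v \<otimes> x \<oplus> u) \<otimes> d x"
      unfolding v(2) using c(1,2) x derivation_closed[OF x] by algebra
    finally show ?case using W.add[OF W.shift[OF v(1)] u(1)] by blast
  }
qed

end

end

lemma (in ring) add_pow_in_subring: "subring L R \<Longrightarrow> b \<in> L \<Longrightarrow> [(n::nat)] \<cdot> b \<in> L"
  by (induction n) (auto simp: subringE(2,7))

text \<open>Differentiating a relation for \<open>x\<close> with constant coefficients gives one of smaller degree whose
leading coefficient is the old one times a positive integer.\<close>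
lemma (in domain) transc_over_constants:
  assumes d: "derivation d" and x: "x \<in> carrier R" "d x \<noteq> \<zero>"
    and char0: "\<And>n::nat. n > 0 \<Longrightarrow> [n] \<cdot> \<one> \<noteq> \<zero>"
  shows "transc {c \<in> carrier R. d c = \<zero>} x"
proof -
  let ?L = "{c \<in> carrier R. d c = \<zero>}"
  have L: "subring ?L R" using constants_subring[OF d] .
  interpret W: poly_vals_over R ?L x using L x by (intro poly_vals_overI)
  show ?thesis
  proof (rule transcI_lead_coeff[OF L x(1)])
    show "x \<noteq> \<zero>" using x derivation_zero[OF d] by auto
    show "b = \<zero>" if "b \<in> ?L" "b \<otimes> x [^] n \<in> poly_vals ?L x n" for n b
      using that
    proof (induction n arbitrary: b)
      case 0
      then show ?case by simp
    next
      case (Suc n)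
      have b: "b \<in> carrier R" "d b = \<zero>" using Suc.prems by auto
      let ?k = "[Suc n] \<cdot> \<one>"
      have k: "?k \<in> carrier R" "?k \<noteq> \<zero>" using char0[of "Suc n"] by auto
      have xn: "x [^] n \<in> carrier R" "d x \<in> carrier R" using x derivation_closed[OF d] by auto
      obtain v where v: "v \<in> poly_vals ?L x n" "d (b \<otimes> x [^] Suc n) = v \<otimes> d x"
        using derivation_poly_vals[OF d x(1) Suc.prems(2)] by blast
      have vc: "v \<in> carrier R" using W.carr v(1) .
      have "d (b \<otimes> x [^] Suc n) = b \<otimes> d (x [^] Suc n)"
        using b x derivation_mult[OF d] derivation_closed[OF d] by simp
      also have "\<dots> = ((b \<otimes> ?k) \<otimes> x [^] n) \<otimes> d x"
        unfolding derivation_pow[OF d x(1)] using b xn k(1) by algebra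
      finally have "((b \<otimes> ?k) \<otimes> x [^] n) \<otimes> d x = v \<otimes> d x" using v(2) by simp
      then have "(b \<otimes> ?k) \<otimes> x [^] n = v"
        using m_rcancel[OF x(2)] xn vc b k by (metis m_closed)
      moreover have "b \<otimes> ?k \<in> ?L"
        using subringE(6)[OF L Suc.prems(1) add_pow_in_subring[OF L subringE(3)[OF L]]] .
      ultimately have "b \<otimes> ?k = \<zero>" using Suc.IH v(1) by blast
      then show ?case using integral b k by blast
    qed
  qed
qed

text \<open>Multiplication by a nonzero element is injective, hence surjective on a finite subring.\<close>
lemma (in field) finite_subring_inverse:
  assumes S: "subring S R" "finite S" and a: "a \<in> S" "a \<noteq> \<zero>"
  shows "inv a \<in> S"
proof -
  have c: "s \<in> S \<Longrightarrow> s \<in> carrier R" for s using subringE(1)[OF S(1)] by auto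
  note ia = inv_simps[OF c[OF a(1)] a(2)]
  have "inj_on ((\<otimes>) a) S"
    using m_lcancel[OF a(2) c[OF a(1)]] c by (auto intro: inj_onI)
  moreover have "(\<otimes>) a ` S \<subseteq> S" using subringE(6)[OF S(1) a(1)] by auto
  ultimately have "(\<otimes>) a ` S = S" using S(2) by (simp add: endo_inj_surj)
  then obtain e where e: "e \<in> S" "a \<otimes> e = \<one>" using subringE(3)[OF S(1)] by (metis imageE)
  then have "inv a = e" using c[OF a(1)] c[OF e(1)] m_comm inv_char by metis
  then show ?thesis using e(1) by simp
qed

text \<open>Let the finite subring have \<open>q\<close> elements. It is a field, so \<open>x\<^sup>q = x\<close> by Lagrange's theorem in its
multiplicative group, and \<open>q \<cdot> 1 = 0\<close> by Lagrange's theorem in its additive group. Differentiating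
\<open>x\<^sup>q\<close> gives \<open>d x = q \<cdot> x\<^sup>q\<^sup>-\<^sup>1 d x = 0\<close>.\<close>
lemma (in field) derivation_zero_on_finite_subring:
  assumes d: "derivation d" and S: "subring S R" "finite S" and x: "x \<in> S"
  shows "d x = \<zero>"
proof (cases "x = \<zero>")
  case True
  then show ?thesis using derivation_zero[OF d] by simp
next
  case False
  let ?S = "R \<lparr> carrier := S \<rparr>"
  have xc: "x \<in> carrier R" using subringE(1)[OF S(1)] x by auto
  have "subfield S R" by (rule subfieldI'[OF S(1)]) (use finite_subring_inverse[OF S] in auto)
  then have "field ?S" using subfield_iff(2) by blast
  then interpret F: field ?S .
  have units: "Units ?S = S - {\<zero>}" using F.field_Units by simp
  have cU: "card (Units ?S) = card S - 1" unfolding units using subringE(2)[OF S(1)] S(2) by simp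
  have card: "card S = Suc (card S - 1)" using S(2) x by (metis Suc_diff_1 card_gt_0_iff empty_iff)
  have "x [^] (card S - 1) = \<one>"
    using F.units_power_order_eq_one[of x] units S(2) x False cU nat_pow_consistent by simp
  then have xq: "x [^] card S = x" using card xc by (metis l_one nat_pow_Suc)
  have "[card S] \<cdot>\<^bsub>?S\<^esub> \<one> = \<zero>"
    using F.add.power_order_eq_one[of \<one>] S(2) subringE(3)[OF S(1)] by simp
  then have q0: "[card S] \<cdot> \<one> = \<zero>" unfolding add_pow_def nat_pow_def by simp
  have "d x = [card S] \<cdot> \<one> \<otimes> (x [^] (card S - 1) \<otimes> d x)"
    using derivation_pow[OF d xc, of "card S - 1"] xq card by metis
  also have "\<dots> = \<zero>" unfolding q0 using xc derivation_closed[OF d xc] by simp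
  finally show ?thesis .
qed

lemma (in cring) prime_subring_finite:
  assumes "N > 0" "add_pow R (N::nat) \<one> = \<zero>"
  shows "subring (range (\<lambda>k::nat. add_pow R k \<one>)) R" "finite (range (\<lambda>k::nat. add_pow R k \<one>))"
proof -
  let ?P = "range (\<lambda>k::nat. add_pow R k \<one>)"
  have mult: "add_pow R k \<one> \<otimes> add_pow R l \<one> = add_pow R (k * l) \<one>" for k l :: nat
    using add_pow_ldistr[of \<one> "add_pow R l \<one>" k] add.nat_pow_pow[of \<one> k l] by (simp add: mult.commute)
  have zero: "add_pow R (N * k) \<one> = \<zero>" for k
    using mult[of N k] assms(2) by simp
  have mod: "add_pow R k \<one> = add_pow R (k mod N) \<one>" for k
  proof -
    have "add_pow R k \<one> = add_pow R (N * (k div N)) \<one> \<oplus> add_pow R (k mod N) \<one>"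
      using add.nat_pow_mult[of \<one> "N * (k div N)" "k mod N"] by simp
    then show ?thesis using zero by simp
  qed
  have "?P \<subseteq> (\<lambda>k. add_pow R k \<one>) ` {..<N}"
  proof
    fix h assume "h \<in> ?P"
    then obtain k :: nat where "h = add_pow R k \<one>" by blast
    then show "h \<in> (\<lambda>k. add_pow R k \<one>) ` {..<N}"
      using mod assms(1) by (intro image_eqI[of _ _ "k mod N"]) simp_all
  qed
  then show "finite ?P" by (rule finite_subset) simp
  show "subring ?P R"
  proof (rule subringI)
    show "?P \<subseteq> carrier R" by auto
    show "\<one> \<in> ?P" by (rule range_eqI[of _ _ 1]) simp
    show "h \<otimes> k \<in> ?P" "h \<oplus> k \<in> ?P" if "h \<in> ?P" "k \<in> ?P" for h k
      using that mult add.nat_pow_mult[of \<one>] by auto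
    show "\<ominus> h \<in> ?P" if h: "h \<in> ?P" for h
    proof -
      obtain k :: nat where k: "h = add_pow R k \<one>" using h by blast
      have "add_pow R (N * k - k) \<one> \<oplus> add_pow R k \<one> = \<zero>"
        using add.nat_pow_mult[of \<one> "N * k - k" k] zero[of k] assms(1) by simp
      then have "\<ominus> h = add_pow R (N * k - k) \<one>" unfolding k by (simp add: minus_equality)
      then show ?thesis by blast
    qed
  qed
qed

text \<open>A relation with nonzero leading coefficient over the finite field \<open>P\<close> reduces all powers of \<open>x\<close> to
a bounded degree.\<close>
lemma (in field) finite_simple_extension:
  assumes P: "subring P R" "finite P" and x: "x \<in> carrier R" "x \<noteq> \<zero>" and alg: "\<not> transc P x"
  shows "finite (simple_extension P x)"
proof -
  interpret W: poly_vals_over R P x using P x by (intro poly_vals_overI)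
  obtain n b where b: "b \<in> P" "b \<noteq> \<zero>" "b \<otimes> x [^] n \<in> poly_vals P x n"
    using transcI_lead_coeff[OF P(1) x] alg by blast
  have bc: "b \<in> carrier R" using W.L_carr b(1) .
  note ib = inv_simps[OF bc b(2)]
  have ibP: "inv b \<in> P" using finite_subring_inverse[OF P b(1,2)] .
  have "inv b \<otimes> (b \<otimes> x [^] n) = x [^] n" using ib bc x by (simp add: m_assoc[symmetric])
  then have xn: "x [^] n \<in> poly_vals P x n" using W.scale[OF ibP b(3)] by simp
  have red: "w \<in> poly_vals P x n" if w: "w \<in> poly_vals P x (Suc n)" for w
  proof -
    obtain c v where "c \<in> P" "v \<in> poly_vals P x n" "w = c \<otimes> x [^] n \<oplus> v"
      using w by (rule W.top_decomp)
    then show ?thesis using W.add[OF W.scale[OF _ xn]] by simp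
  qed
  have "simple_extension P x \<subseteq> poly_vals P x n"
  proof
    fix w assume "w \<in> simple_extension P x"
    then show "w \<in> poly_vals P x n"
    proof (induction rule: simple_extension.induct)
      case zero
      show ?case by (rule W.zero)
    next
      case (lin v c)
      then show ?case using red poly_vals_SucI by blast
    qed
  qed
  then show ?thesis using finite_poly_vals[OF P(2)] finite_subset by blast
qed

text \<open>If \<open>d x \<noteq> 0\<close>, then \<open>x\<close> is transcendental over some subring: over the constants of \<open>d\<close> in
characteristic zero, and over the prime field in positive characteristic, since otherwise \<open>x\<close> would
lie in a finite subring.\<close>
lemma (in field) derivation_zero_if_finite_RgMax:
  assumes fin: "finite (RgMax R)" and d: "derivation d" and x: "x \<in> carrier R"
  shows "d x = \<zero>"
proof (rule ccontr)
  assume dx: "d x \<noteq> \<zero>"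
  then have x0: "x \<noteq> \<zero>" using derivation_zero[OF d] by auto
  show False
  proof (cases "\<exists>N::nat. N > 0 \<and> [N] \<cdot> \<one> = \<zero>")
    case False
    then have "transc {c \<in> carrier R. d c = \<zero>} x" using transc_over_constants[OF d x dx] by blast
    then show False using infinite_RgMax_if_transc[OF x constants_subring[OF d]] fin by blast
  next
    case True
    then obtain N where "N > 0" "[(N::nat)] \<cdot> \<one> = \<zero>" by blast
    from prime_subring_finite[OF this] obtain P where P: "subring P R" "finite P" by blast
    have "\<not> transc P x" using infinite_RgMax_if_transc[OF x P(1)] fin by blast
    then have "finite (simple_extension P x)" using finite_simple_extension[OF P x x0] by blast
    then show False
      using derivation_zero_on_finite_subring[OF d simple_extension_is_subring[OF P(1) x]]
        simple_extension_mem[OF P(1) x] dx by blast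
  qed
qed

section \<open>Maximal subrings and ring isomorphisms\<close>

lemma maximal_subring_ring_iso_image:
  assumes A: "ring A" and B: "ring B" and h: "h \<in> ring_iso A B" and S: "maximal_subring S A"
  shows "maximal_subring (h ` S) B"
proof -
  let ?g = "inv_into (carrier A) h"
  have g: "?g \<in> ring_iso B A" using ring_iso_set_sym[OF A h] .
  interpret H: ring_hom_ring A B h using h by (simp add: ring_iso_def A B ring_hom_ringI2)
  interpret G: ring_hom_ring B A ?g using g by (simp add: ring_iso_def A B ring_hom_ringI2)
  have bij: "bij_betw h (carrier A) (carrier B)" using h ring_iso_memE(5) by blast
  have sub: "subring S A" "S \<noteq> carrier A"
    and max: "\<And>T. subring T A \<Longrightarrow> T \<noteq> carrier A \<Longrightarrow> S \<subseteq> T \<Longrightarrow> T = S"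
    using S unfolding maximal_subring_def by auto
  have Sc: "S \<subseteq> carrier A" using subringE(1)[OF sub(1)] .
  have ghS: "?g ` h ` S = S" using bij Sc by (simp add: bij_betw_def inv_into_image_cancel)
  show ?thesis unfolding maximal_subring_def
  proof (intro conjI allI impI)
    show "subring (h ` S) B" using H.img_is_subring[OF sub(1)] .
    show "h ` S \<noteq> carrier B"
    proof
      assume "h ` S = carrier B"
      then have "S = ?g ` carrier B" using ghS by simp
      then show False using sub(2) g by (simp add: ring_iso_def bij_betw_def)
    qed
    fix T assume T: "subring T B \<and> T \<noteq> carrier B \<and> h ` S \<subseteq> T"
    then have Tc: "T \<subseteq> carrier B" using subringE(1)[of T B] by blast
    have hgT: "h ` ?g ` T = T" using bij Tc by (simp add: bij_betw_def image_inv_into_cancel)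
    have "?g ` T = S"
    proof (rule max)
      show "subring (?g ` T) A" using G.img_is_subring T by blast
      show "?g ` T \<noteq> carrier A" using hgT T bij by (auto simp: bij_betw_def)
      show "S \<subseteq> ?g ` T" using image_mono[of "h ` S" T ?g] T ghS by simp
    qed
    then show "T = h ` S" using hgT by simp
  qed
qed

lemma RgMax_ring_iso:
  assumes A: "ring A" and B: "ring B" and h: "h \<in> ring_iso A B"
  shows "bij_betw ((`) h) (RgMax A) (RgMax B)"
proof (rule bij_betwI')
  let ?g = "inv_into (carrier A) h"
  have g: "?g \<in> ring_iso B A" using ring_iso_set_sym[OF A h] .
  have bij: "bij_betw h (carrier A) (carrier B)" using h ring_iso_memE(5) by blast
  show "(h ` S = h ` T) = (S = T)" if "S \<in> RgMax A" "T \<in> RgMax A" for S T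
    using that bij inj_on_image_eq_iff[of h "carrier A" S T] subringE(1)[of S A] subringE(1)[of T A]
    unfolding RgMax_def maximal_subring_def bij_betw_def by blast
  show "h ` S \<in> RgMax B" if "S \<in> RgMax A" for S
    using that maximal_subring_ring_iso_image[OF A B h] unfolding RgMax_def by blast
  show "\<exists>S\<in>RgMax A. T = h ` S" if "T \<in> RgMax B" for T
  proof -
    have T: "maximal_subring T B" using that unfolding RgMax_def by blast
    then have "T \<subseteq> carrier B" using subringE(1)[of T B] unfolding maximal_subring_def by blast
    then have "h ` ?g ` T = T" using bij by (simp add: bij_betw_def image_inv_into_cancel)
    then show ?thesis using maximal_subring_ring_iso_image[OF B A g T] unfolding RgMax_def by auto
  qed
qed

section \<open>Maximal subrings of the dual numbers\<close>

text \<open>The dual numbers on pairs: \<open>(a, b)\<close> stands for \<open>a + b \<alpha>\<close>.\<close>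
definition (in ring) dual_pairs :: "('a \<times> 'a) ring" where
  "dual_pairs = \<lparr> carrier = carrier R \<times> carrier R,
     monoid.mult = (\<lambda>(a, b) (c, e). (a \<otimes> c, a \<otimes> e \<oplus> b \<otimes> c)),
     one = (\<one>, \<zero>), ring.zero = (\<zero>, \<zero>),
     ring.add = (\<lambda>(a, b) (c, e). (a \<oplus> c, b \<oplus> e)) \<rparr>"

lemma (in ring) dual_pairs_simps [simp]:
  "carrier dual_pairs = carrier R \<times> carrier R"
  "(a, b) \<otimes>\<^bsub>dual_pairs\<^esub> (c, e) = (a \<otimes> c, a \<otimes> e \<oplus> b \<otimes> c)"
  "\<one>\<^bsub>dual_pairs\<^esub> = (\<one>, \<zero>)" "\<zero>\<^bsub>dual_pairs\<^esub> = (\<zero>, \<zero>)"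
  "(a, b) \<oplus>\<^bsub>dual_pairs\<^esub> (c, e) = (a \<oplus> c, b \<oplus> e)"
  by (simp_all add: dual_pairs_def)

lemma (in cring) dual_pairs_ring: "ring dual_pairs"
proof (rule ringI)
  show "abelian_group dual_pairs"
  proof (rule abelian_groupI)
    fix p assume p: "p \<in> carrier dual_pairs"
    show "\<exists>q\<in>carrier dual_pairs. q \<oplus>\<^bsub>dual_pairs\<^esub> p = \<zero>\<^bsub>dual_pairs\<^esub>"
      using p by (intro bexI[of _ "(\<ominus> fst p, \<ominus> snd p)"]) (auto simp: l_neg)
  qed (auto simp: a_ac)
  show "monoid dual_pairs"
    by (rule monoidI) (auto simp: m_assoc l_distr r_distr a_ac)
qed (auto simp: l_distr r_distr a_ac)

lemma (in cring) dual_pairs_uminus: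
  assumes "a \<in> carrier R" "b \<in> carrier R"
  shows "\<ominus>\<^bsub>dual_pairs\<^esub> (a, b) = (\<ominus> a, \<ominus> b)"
proof -
  interpret E: ring dual_pairs by (rule dual_pairs_ring)
  show ?thesis using assms by (intro E.minus_equality) (auto simp: l_neg)
qed

lemma (in cring) subring_dual_pairsI:
  assumes "S \<subseteq> carrier R \<times> carrier R" "(\<one>, \<zero>) \<in> S"
    "\<And>a b. (a, b) \<in> S \<Longrightarrow> (\<ominus> a, \<ominus> b) \<in> S"
    "\<And>a b c e. (a, b) \<in> S \<Longrightarrow> (c, e) \<in> S \<Longrightarrow> (a \<otimes> c, a \<otimes> e \<oplus> b \<otimes> c) \<in> S"
    "\<And>a b c e. (a, b) \<in> S \<Longrightarrow> (c, e) \<in> S \<Longrightarrow> (a \<oplus> c, b \<oplus> e) \<in> S"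
  shows "subring S dual_pairs"
proof -
  interpret E: ring dual_pairs by (rule dual_pairs_ring)
  show ?thesis
  proof (rule E.subringI)
    fix p assume p: "p \<in> S"
    then obtain a b where "p = (a, b)" "a \<in> carrier R" "b \<in> carrier R" using assms(1) by blast
    then show "\<ominus>\<^bsub>dual_pairs\<^esub> p \<in> S" using assms(3) p dual_pairs_uminus by simp
    fix q assume q: "q \<in> S"
    show "p \<otimes>\<^bsub>dual_pairs\<^esub> q \<in> S" "p \<oplus>\<^bsub>dual_pairs\<^esub> q \<in> S"
      using assms(4,5) p q by (cases p; cases q; simp)+
  qed (use assms in auto)
qed

lemma (in cring) subring_dual_pairsE:
  assumes "subring S dual_pairs"
  shows "S \<subseteq> carrier R \<times> carrier R" "(\<one>, \<zero>) \<in> S" "(\<zero>, \<zero>) \<in> S"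
    "\<And>a b. (a, b) \<in> S \<Longrightarrow> (\<ominus> a, \<ominus> b) \<in> S"
    "\<And>a b c e. (a, b) \<in> S \<Longrightarrow> (c, e) \<in> S \<Longrightarrow> (a \<otimes> c, a \<otimes> e \<oplus> b \<otimes> c) \<in> S"
    "\<And>a b c e. (a, b) \<in> S \<Longrightarrow> (c, e) \<in> S \<Longrightarrow> (a \<oplus> c, b \<oplus> e) \<in> S"
proof -
  show sub: "S \<subseteq> carrier R \<times> carrier R" "(\<one>, \<zero>) \<in> S" "(\<zero>, \<zero>) \<in> S"
    using subringE(1,2,3)[OF assms] by auto
  show "(\<ominus> a, \<ominus> b) \<in> S" if "(a, b) \<in> S" for a b
    using subringE(5)[OF assms that] dual_pairs_uminus[of a b] sub that by auto
  show "(a \<otimes> c, a \<otimes> e \<oplus> b \<otimes> c) \<in> S" "(a \<oplus> c, b \<oplus> e) \<in> S"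
    if "(a, b) \<in> S" "(c, e) \<in> S" for a b c e
    using subringE(6,7)[OF assms that] by auto
qed

lemma (in cring) subring_fst_image:
  assumes S: "subring S dual_pairs"
  shows "subring (fst ` S) R"
proof -
  note E = subring_dual_pairsE[OF S]
  show ?thesis
  proof (rule subringI)
    show "fst ` S \<subseteq> carrier R" using E(1) by auto
    show "\<one> \<in> fst ` S" using E(2) by force
    show "\<ominus> h \<in> fst ` S" if "h \<in> fst ` S" for h using that E(4) by force
    show "h \<otimes> k \<in> fst ` S" "h \<oplus> k \<in> fst ` S" if "h \<in> fst ` S" "k \<in> fst ` S" for h k
      using that E(5,6) by force+
  qed
qed

lemma (in cring) subring_times_carrier:
  assumes "subring M R" shows "subring (M \<times> carrier R) dual_pairs"
  by (rule subring_dual_pairsI) (use subringE[OF assms] in \<open>auto simp: subset_iff\<close>)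

lemma (in cring) subring_containing_nilradical:
  assumes S: "subring S dual_pairs" and N: "{\<zero>} \<times> carrier R \<subseteq> S"
  shows "S = fst ` S \<times> carrier R"
proof -
  note E = subring_dual_pairsE[OF S]
  have "(a, c) \<in> S" if "(a, b) \<in> S" "c \<in> carrier R" for a b c
  proof -
    have ab: "a \<in> carrier R" "b \<in> carrier R" using E(1) that by auto
    have "(\<zero>, \<ominus> b \<oplus> c) \<in> S" using N ab that(2) by auto
    from E(6)[OF that(1) this] have "(a \<oplus> \<zero>, b \<oplus> (\<ominus> b \<oplus> c)) \<in> S" .
    then show ?thesis using ab that(2) by (simp add: r_neg2)
  qed
  then show ?thesis using E(1) by force
qed

text \<open>The maximal subrings containing the nilradical correspond to those of the residue ring; this
lemma and the next are the two directions.\<close>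
lemma (in cring) maximal_subring_times_carrier:
  assumes "maximal_subring M R"
  shows "maximal_subring (M \<times> carrier R) dual_pairs"
proof -
  have M: "subring M R" "M \<noteq> carrier R"
    and max: "\<And>M'. subring M' R \<Longrightarrow> M' \<noteq> carrier R \<Longrightarrow> M \<subseteq> M' \<Longrightarrow> M' = M"
    using assms unfolding maximal_subring_def by auto
  show ?thesis unfolding maximal_subring_def
  proof (intro conjI allI impI)
    show "subring (M \<times> carrier R) dual_pairs" using subring_times_carrier[OF M(1)] .
    show "M \<times> carrier R \<noteq> carrier dual_pairs" using M(2) zero_closed by (auto simp: times_eq_iff)
    fix S assume S: "subring S dual_pairs \<and> S \<noteq> carrier dual_pairs \<and> M \<times> carrier R \<subseteq> S"
    then have "{\<zero>} \<times> carrier R \<subseteq> S" using subringE(2)[OF M(1)] by blast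
    then have eq: "S = fst ` S \<times> carrier R" using subring_containing_nilradical S by blast
    have fM: "fst ` S = M"
    proof (rule max)
      show "subring (fst ` S) R" using subring_fst_image S by blast
      show "fst ` S \<noteq> carrier R"
      proof
        assume f: "fst ` S = carrier R"
        have "S = carrier dual_pairs" using eq unfolding f dual_pairs_simps(1) .
        then show False using S by blast
      qed
      show "M \<subseteq> fst ` S"
      proof
        fix a assume "a \<in> M"
        then have "(a, \<zero>) \<in> S" using S zero_closed by blast
        then show "a \<in> fst ` S" by (rule rev_image_eqI) simp
      qed
    qed
    show "S = M \<times> carrier R" using eq unfolding fM .
  qed
qed

lemma (in cring) maximal_subring_containing_nilradical:
  assumes S: "maximal_subring S dual_pairs" and N: "{\<zero>} \<times> carrier R \<subseteq> S"
  shows "maximal_subring (fst ` S) R"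
proof -
  have sub: "subring S dual_pairs" "S \<noteq> carrier dual_pairs"
    and max: "\<And>T. subring T dual_pairs \<Longrightarrow> T \<noteq> carrier dual_pairs \<Longrightarrow> S \<subseteq> T \<Longrightarrow> T = S"
    using S unfolding maximal_subring_def by auto
  have eq: "S = fst ` S \<times> carrier R" using subring_containing_nilradical[OF sub(1) N] .
  show ?thesis unfolding maximal_subring_def
  proof (intro conjI allI impI)
    show "subring (fst ` S) R" using subring_fst_image[OF sub(1)] .
    show "fst ` S \<noteq> carrier R"
    proof
      assume f: "fst ` S = carrier R"
      have "S = carrier dual_pairs" using eq unfolding f dual_pairs_simps(1) .
      then show False using sub(2) by blast
    qed
    fix M assume M: "subring M R \<and> M \<noteq> carrier R \<and> fst ` S \<subseteq> M"
    have "M \<times> carrier R = S"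
    proof (rule max)
      show "subring (M \<times> carrier R) dual_pairs" using subring_times_carrier M by blast
      show "M \<times> carrier R \<noteq> carrier dual_pairs" using M zero_closed by (auto simp: times_eq_iff)
      show "S \<subseteq> M \<times> carrier R"
      proof
        fix p assume p: "p \<in> S"
        then have "fst p \<in> M" using M by blast
        moreover have "p \<in> carrier R \<times> carrier R" using subring_dual_pairsE(1)[OF sub(1)] p by blast
        ultimately show "p \<in> M \<times> carrier R" by (simp add: mem_Times_iff)
      qed
    qed
    then have "fst ` (M \<times> carrier R) = fst ` S" by (rule arg_cong)
    moreover have "carrier R \<noteq> {}" using zero_closed by blast
    ultimately show "M = fst ` S" by (simp only: fst_image_times if_False)
  qed
qed

text \<open>A subring that surjects onto the field acts on the nilradical as the whole field does, and the
nilradical is one-dimensional.\<close>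
lemma (in field) nilpotent_generates:
  assumes S: "subring S dual_pairs" and full: "fst ` S = carrier R" and b: "(\<zero>, b) \<in> S" "b \<noteq> \<zero>"
  shows "{\<zero>} \<times> carrier R \<subseteq> S"
proof
  note E = subring_dual_pairsE[OF S]
  fix p assume "p \<in> {\<zero>} \<times> carrier R"
  then obtain c where c: "p = (\<zero>, c)" "c \<in> carrier R" by blast
  have bc: "b \<in> carrier R" using E(1) b(1) by blast
  note ib = inv_simps[OF bc b(2)]
  have "c \<otimes> inv b \<in> fst ` S" using full c(2) ib(1) by simp
  then obtain e where e: "(c \<otimes> inv b, e) \<in> S" by force
  then have ec: "e \<in> carrier R" using E(1) by blast
  have "(c \<otimes> inv b \<otimes> \<zero>, c \<otimes> inv b \<otimes> b \<oplus> e \<otimes> \<zero>) \<in> S" using E(5)[OF e b(1)] .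
  moreover have "c \<otimes> inv b \<otimes> b = c" using c(2) bc ib by (simp add: m_assoc)
  ultimately show "p \<in> S" using c ec ib(1) by simp
qed

text \<open>Adding the nilradical to such an \<open>S\<close> gives the whole ring by maximality, so \<open>S\<close> surjects onto the
field; by the previous lemma \<open>S\<close> meets the nilradical only in zero. So \<open>S\<close> is the graph of a map,
and closure under multiplication is the Leibniz rule.\<close>
lemma (in field) maximal_subring_avoiding_nilradical:
  assumes S: "maximal_subring S dual_pairs" and N: "\<not> {\<zero>} \<times> carrier R \<subseteq> S"
  shows "\<exists>d. derivation d \<and> S = {(a, d a) | a. a \<in> carrier R}"
proof -
  have sub: "subring S dual_pairs" "S \<noteq> carrier dual_pairs"
    and max: "\<And>T. subring T dual_pairs \<Longrightarrow> T \<noteq> carrier dual_pairs \<Longrightarrow> S \<subseteq> T \<Longrightarrow> T = S"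
    using S unfolding maximal_subring_def by auto
  note E = subring_dual_pairsE[OF sub(1)]
  have full: "fst ` S = carrier R"
  proof (rule ccontr)
    assume n: "fst ` S \<noteq> carrier R"
    have "fst ` S \<times> carrier R = S"
    proof (rule max)
      show "subring (fst ` S \<times> carrier R) dual_pairs"
        using subring_times_carrier[OF subring_fst_image[OF sub(1)]] .
      show "fst ` S \<times> carrier R \<noteq> carrier dual_pairs" using n zero_closed by (auto simp: times_eq_iff)
      show "S \<subseteq> fst ` S \<times> carrier R"
      proof
        fix p assume p: "p \<in> S"
        then have "p \<in> carrier R \<times> carrier R" using E(1) by blast
        then show "p \<in> fst ` S \<times> carrier R" using p by (simp add: mem_Times_iff)
      qed
    qed
    moreover have "\<zero> \<in> fst ` S" using E(3) by force
    ultimately show False using N by blast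
  qed
  have uniq: "b = b'" if "(a, b) \<in> S" "(a, b') \<in> S" for a b b'
  proof -
    have c: "a \<in> carrier R" "b \<in> carrier R" "b' \<in> carrier R" using E(1) that by auto
    have "(a \<oplus> \<ominus> a, b \<oplus> \<ominus> b') \<in> S" using E(6)[OF that(1) E(4)[OF that(2)]] .
    then have "(\<zero>, b \<ominus> b') \<in> S" using c by (simp add: r_neg a_minus_def)
    then have "b \<ominus> b' = \<zero>" using nilpotent_generates[OF sub(1) full] N by blast
    then show ?thesis using c by simp
  qed
  define d where "d a = (THE b. (a, b) \<in> S)" for a
  have d: "d a = b" if "(a, b) \<in> S" for a b
    unfolding d_def using that uniq by (intro the_equality) blast+
  have mem: "(a, d a) \<in> S" if a: "a \<in> carrier R" for a
  proof -
    obtain b where "(a, b) \<in> S" using full a by force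
    then show ?thesis using d by simp
  qed
  have "derivation d" unfolding derivation_def
  proof (intro conjI ballI)
    show "d \<in> carrier R \<rightarrow> carrier R" using mem E(1) by blast
    fix a b assume ab: "a \<in> carrier R" "b \<in> carrier R"
    show "d (a \<oplus> b) = d a \<oplus> d b" using d[OF E(6)[OF mem mem]] ab by blast
    have "d (a \<otimes> b) = a \<otimes> d b \<oplus> d a \<otimes> b" using d[OF E(5)[OF mem mem]] ab by blast
    moreover have "d a \<in> carrier R" "d b \<in> carrier R" using mem ab E(1) by blast+
    ultimately show "d (a \<otimes> b) = d a \<otimes> b \<oplus> a \<otimes> d b" using ab by (simp add: a_comm)
  qed
  moreover have "S = {(a, d a) | a. a \<in> carrier R}"
    using mem d E(1) by auto
  ultimately show ?thesis by blast
qed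

lemma (in field) maximal_subring_constants: "maximal_subring (carrier R \<times> {\<zero>}) dual_pairs"
  unfolding maximal_subring_def
proof (intro conjI allI impI)
  show "subring (carrier R \<times> {\<zero>}) dual_pairs"
    by (rule subring_dual_pairsI) auto
  have "(\<one>, \<one>) \<in> carrier dual_pairs - carrier R \<times> {\<zero>}" by simp
  then show "carrier R \<times> {\<zero>} \<noteq> carrier dual_pairs" by blast
  fix S assume S: "subring S dual_pairs \<and> S \<noteq> carrier dual_pairs \<and> carrier R \<times> {\<zero>} \<subseteq> S"
  then have sub: "subring S dual_pairs" by blast
  note E = subring_dual_pairsE[OF sub]
  have full: "fst ` S = carrier R"
  proof
    show "fst ` S \<subseteq> carrier R" using subringE(1)[OF subring_fst_image[OF sub]] .
    show "carrier R \<subseteq> fst ` S"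
    proof
      fix a assume "a \<in> carrier R"
      then have "(a, \<zero>) \<in> S" using S by blast
      then show "a \<in> fst ` S" by (rule rev_image_eqI) simp
    qed
  qed
  have "b = \<zero>" if ab: "(a, b) \<in> S" for a b
  proof (rule ccontr)
    assume b: "b \<noteq> \<zero>"
    have c: "a \<in> carrier R" "b \<in> carrier R" using E(1) ab by auto
    then have "(\<ominus> a, \<zero>) \<in> carrier R \<times> {\<zero>}" by simp
    then have "(\<ominus> a, \<zero>) \<in> S" using S by (meson subsetD)
    from E(6)[OF ab this] have "(\<zero>, b) \<in> S" using c by (simp add: r_neg)
    from nilpotent_generates[OF sub full this b]
    have "S = carrier dual_pairs"
      using subring_containing_nilradical[OF sub] unfolding full dual_pairs_simps(1) by blast
    then show False using S by blast
  qed
  then have "S \<subseteq> carrier R \<times> {\<zero>}" using E(1) by auto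
  then show "S = carrier R \<times> {\<zero>}" using S by blast
qed

lemma (in field) RgMax_dual_pairs:
  assumes fin: "finite (RgMax R)"
  shows "RgMax dual_pairs = insert (carrier R \<times> {\<zero>}) ((\<lambda>M. M \<times> carrier R) ` RgMax R)"
proof (intro equalityI subsetI)
  fix S assume "S \<in> RgMax dual_pairs"
  then have S: "maximal_subring S dual_pairs" unfolding RgMax_def by blast
  show "S \<in> insert (carrier R \<times> {\<zero>}) ((\<lambda>M. M \<times> carrier R) ` RgMax R)"
  proof (cases "{\<zero>} \<times> carrier R \<subseteq> S")
    case True
    have "S = fst ` S \<times> carrier R"
      using subring_containing_nilradical[OF _ True] S unfolding maximal_subring_def by blast
    then show ?thesis
      using maximal_subring_containing_nilradical[OF S True] unfolding RgMax_def by blast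
  next
    case False
    obtain d where d: "derivation d" "S = {(a, d a) | a. a \<in> carrier R}"
      using maximal_subring_avoiding_nilradical[OF S False] by blast
    then have "S = carrier R \<times> {\<zero>}" using derivation_zero_if_finite_RgMax[OF fin d(1)] by auto
    then show ?thesis by blast
  qed
next
  fix S assume "S \<in> insert (carrier R \<times> {\<zero>}) ((\<lambda>M. M \<times> carrier R) ` RgMax R)"
  then show "S \<in> RgMax dual_pairs"
    using maximal_subring_constants maximal_subring_times_carrier unfolding RgMax_def by blast
qed

lemma (in field) finite_card_RgMax_dual_pairs:
  "finite (RgMax dual_pairs) \<longleftrightarrow> finite (RgMax R)"
  "finite (RgMax R) \<Longrightarrow> card (RgMax dual_pairs) = 1 + card (RgMax R)"
proof -
  have inj: "inj_on (\<lambda>M. M \<times> carrier R) (RgMax R)"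
    using zero_closed by (intro inj_onI) (auto simp: times_eq_iff)
  have "(\<lambda>M. M \<times> carrier R) ` RgMax R \<subseteq> RgMax dual_pairs"
    using maximal_subring_times_carrier unfolding RgMax_def by blast
  then show "finite (RgMax dual_pairs) \<longleftrightarrow> finite (RgMax R)"
    using RgMax_dual_pairs inj finite_imageD finite_subset by (metis finite_imageI finite_insert)
  assume fin: "finite (RgMax R)"
  have "carrier R \<times> {\<zero>} \<notin> (\<lambda>M. M \<times> carrier R) ` RgMax R"
  proof
    assume "carrier R \<times> {\<zero>} \<in> (\<lambda>M. M \<times> carrier R) ` RgMax R"
    then obtain M where M: "carrier R \<times> {\<zero>} = M \<times> carrier R" by blast
    then have "\<zero> \<in> M" using zero_closed by blast
    then have "(\<zero>, \<one>) \<in> carrier R \<times> {\<zero>}" unfolding M by simp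
    then show False by simp
  qed
  then show "card (RgMax dual_pairs) = 1 + card (RgMax R)"
    unfolding RgMax_dual_pairs[OF fin] using fin inj by (simp add: card_image)
qed


section \<open>The quotient by the square of the variable\<close>

definition (in ring) low_coeffs :: "'a list \<Rightarrow> 'a \<times> 'a" where
  "low_coeffs p = (coeff p 0, coeff p 1)"

lemma (in domain) low_coeffs_hom: "ring_hom_ring (poly_ring R) dual_pairs low_coeffs"
proof (rule ring_hom_ringI2)
  show "ring (poly_ring R)" using univ_poly_is_ring[OF carrier_is_subring] .
  show "ring dual_pairs" by (rule dual_pairs_ring)
  have set: "set p \<subseteq> carrier R" if "p \<in> carrier (poly_ring R)" for p
    using that polynomial_incl univ_poly_carrier by blast
  have cc: "coeff p i \<in> carrier R" if "p \<in> carrier (poly_ring R)" for p i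
    using coeff_in_carrier[OF set[OF that]] .
  show "low_coeffs \<in> ring_hom (poly_ring R) dual_pairs"
  proof (rule ring_hom_memI)
    fix p q assume p: "p \<in> carrier (poly_ring R)" and q: "q \<in> carrier (poly_ring R)"
    show "low_coeffs p \<in> carrier dual_pairs" using cc[OF p] by (simp add: low_coeffs_def)
    show "low_coeffs (p \<oplus>\<^bsub>poly_ring R\<^esub> q) = low_coeffs p \<oplus>\<^bsub>dual_pairs\<^esub> low_coeffs q"
      using poly_add_coeff[OF set[OF p] set[OF q]] by (simp add: low_coeffs_def univ_poly_add)
    show "low_coeffs (p \<otimes>\<^bsub>poly_ring R\<^esub> q) = low_coeffs p \<otimes>\<^bsub>dual_pairs\<^esub> low_coeffs q"
      using poly_mult_coeff[OF set[OF p] set[OF q]] cc[OF p] cc[OF q]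
        a_comm[of "coeff p 1 \<otimes> coeff q 0" "coeff p 0 \<otimes> coeff q 1"]
      by (simp add: low_coeffs_def univ_poly_mult)
  qed (simp add: low_coeffs_def univ_poly_one)
qed

lemma (in domain) low_coeffs_surj: "low_coeffs ` carrier (poly_ring R) = carrier dual_pairs"
proof
  show "low_coeffs ` carrier (poly_ring R) \<subseteq> carrier dual_pairs"
    using ring_hom_memE(1)[OF ring_hom_ring.homh[OF low_coeffs_hom]] by blast
  show "carrier dual_pairs \<subseteq> low_coeffs ` carrier (poly_ring R)"
  proof
    fix p assume "p \<in> carrier dual_pairs"
    then obtain a b where ab: "p = (a, b)" "a \<in> carrier R" "b \<in> carrier R" by auto
    have "normalize [b, a] \<in> carrier (poly_ring R)"
      using normalize_gives_polynomial[of "[b, a]" "carrier R"] ab unfolding univ_poly_carrier by simp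
    moreover have "low_coeffs (normalize [b, a]) = p"
      unfolding low_coeffs_def normalize_coeff[symmetric] ab(1) by simp
    ultimately show "p \<in> low_coeffs ` carrier (poly_ring R)" by blast
  qed
qed

text \<open>A polynomial with zero constant term is a multiple of \<open>X\<close>; applied twice to a polynomial in the
kernel, this splits off \<open>X\<^sup>2\<close>.\<close>
lemma (in domain) low_coeffs_kernel:
  "a_kernel (poly_ring R) dual_pairs low_coeffs = PIdl\<^bsub>poly_ring R\<^esub> (X [^]\<^bsub>poly_ring R\<^esub> (2::nat))"
proof -
  interpret P: ring "poly_ring R" using univ_poly_is_ring[OF carrier_is_subring] .
  interpret H: ring_hom_ring "poly_ring R" dual_pairs low_coeffs by (rule low_coeffs_hom)
  have Xc: "X \<in> carrier (poly_ring R)" using var_closed(1)[OF carrier_is_subring] .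
  have X2: "X [^]\<^bsub>poly_ring R\<^esub> (2::nat) = X \<otimes>\<^bsub>poly_ring R\<^esub> X"
    using Xc by (simp add: numeral_2_eq_2)
  have hX: "low_coeffs X = (\<zero>, \<one>)" by (simp add: low_coeffs_def var_def)
  show ?thesis
  proof
    show "PIdl\<^bsub>poly_ring R\<^esub> (X [^]\<^bsub>poly_ring R\<^esub> (2::nat)) \<subseteq> a_kernel (poly_ring R) dual_pairs low_coeffs"
    proof
      fix p assume "p \<in> PIdl\<^bsub>poly_ring R\<^esub> (X [^]\<^bsub>poly_ring R\<^esub> (2::nat))"
      then obtain q where q: "q \<in> carrier (poly_ring R)" "p = q \<otimes>\<^bsub>poly_ring R\<^esub> (X \<otimes>\<^bsub>poly_ring R\<^esub> X)"
        unfolding cgenideal_def X2 by blast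
      have hq: "low_coeffs q \<in> carrier R \<times> carrier R" using H.hom_closed[OF q(1)] by simp
      have "low_coeffs p = low_coeffs q \<otimes>\<^bsub>dual_pairs\<^esub> ((\<zero>, \<one>) \<otimes>\<^bsub>dual_pairs\<^esub> (\<zero>, \<one>))"
        unfolding q(2) using q(1) Xc hX by simp
      also have "\<dots> = \<zero>\<^bsub>dual_pairs\<^esub>" using hq by (cases "low_coeffs q") auto
      finally show "p \<in> a_kernel (poly_ring R) dual_pairs low_coeffs"
        unfolding a_kernel_def' using q Xc by simp
    qed
    show "a_kernel (poly_ring R) dual_pairs low_coeffs \<subseteq> PIdl\<^bsub>poly_ring R\<^esub> (X [^]\<^bsub>poly_ring R\<^esub> (2::nat))"
    proof
      fix p assume "p \<in> a_kernel (poly_ring R) dual_pairs low_coeffs"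
      then have p: "p \<in> carrier (poly_ring R)" "coeff p 0 = \<zero>" "coeff p 1 = \<zero>"
        unfolding a_kernel_def' low_coeffs_def by auto
      have strip: "\<exists>q\<in>carrier (poly_ring R). p = q \<otimes>\<^bsub>poly_ring R\<^esub> X \<and> (\<forall>i. coeff q i = coeff p (Suc i))"
        if p: "p \<in> carrier (poly_ring R)" "coeff p 0 = \<zero>" for p
      proof (cases "p = []")
        case True
        then show ?thesis
          using poly_mult_var[OF carrier_is_subring univ_poly_zero_closed]
          by (intro bexI[of _ "[]"] univ_poly_zero_closed) simp
      next
        case False
        then obtain q c where q: "p = q @ [c]" by (metis rev_exhaust)
        have set: "set p \<subseteq> carrier R" "lead_coeff p \<noteq> \<zero>"
          using p(1) False unfolding univ_poly_carrier[symmetric] polynomial_def by auto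
        have c: "c = \<zero>" using p(2) append_coeff[of q "[c]"] unfolding q by simp
        then have q0: "q \<noteq> []" using set(2) q by auto
        then have qc: "q \<in> carrier (poly_ring R)"
          using set q unfolding univ_poly_carrier[symmetric] polynomial_def by auto
        have "p = q \<otimes>\<^bsub>poly_ring R\<^esub> X"
          using poly_mult_var[OF carrier_is_subring qc] q0 q c by simp
        moreover have "coeff q i = coeff p (Suc i)" for i
          using append_coeff[of q "[c]"] unfolding q by simp
        ultimately show ?thesis using qc by blast
      qed
      obtain q where q: "q \<in> carrier (poly_ring R)" "p = q \<otimes>\<^bsub>poly_ring R\<^esub> X" "coeff q 0 = \<zero>"
        using strip[OF p(1,2)] p(3) by auto
      obtain r where r: "r \<in> carrier (poly_ring R)" "q = r \<otimes>\<^bsub>poly_ring R\<^esub> X"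
        using strip[OF q(1,3)] by blast
      have "p = r \<otimes>\<^bsub>poly_ring R\<^esub> (X \<otimes>\<^bsub>poly_ring R\<^esub> X)"
        unfolding q(2) r(2) using r(1) Xc P.m_assoc by simp
      then show "p \<in> PIdl\<^bsub>poly_ring R\<^esub> (X [^]\<^bsub>poly_ring R\<^esub> (2::nat))"
        unfolding cgenideal_def X2 using r(1) by blast
    qed
  qed
qed

lemma (in domain) dual_numbers_iso:
  "\<exists>h. h \<in> ring_iso (dual_numbers R) dual_pairs" and dual_numbers_ring: "ring (dual_numbers R)"
proof -
  interpret H: ring_hom_ring "poly_ring R" dual_pairs low_coeffs by (rule low_coeffs_hom)
  have eq: "dual_numbers R = poly_ring R Quot a_kernel (poly_ring R) dual_pairs low_coeffs"
    unfolding dual_numbers_def rupture_def low_coeffs_kernel ..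
  show "\<exists>h. h \<in> ring_iso (dual_numbers R) dual_pairs"
    unfolding eq using H.FactRing_iso_set[OF low_coeffs_surj] by blast
  show "ring (dual_numbers R)"
    unfolding eq using ideal.quotient_is_ring[OF H.kernel_is_ideal] .
qed

theorem corollary3p13:
  fixes K :: "('a, 'b) ring_scheme"
  assumes "field K"
  shows "(finite (RgMax (dual_numbers K)) \<longleftrightarrow> finite (RgMax K)) \<and>
    (finite (RgMax K) \<longrightarrow> card (RgMax (dual_numbers K)) = 1 + card (RgMax K))"
proof -
  interpret field K by (rule assms)
  obtain h where "h \<in> ring_iso (dual_numbers K) dual_pairs" using dual_numbers_iso by blast
  then have "bij_betw ((`) h) (RgMax (dual_numbers K)) (RgMax dual_pairs)"
    by (rule RgMax_ring_iso[OF dual_numbers_ring dual_pairs_ring])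
  then have "finite (RgMax (dual_numbers K)) \<longleftrightarrow> finite (RgMax dual_pairs)"
    "card (RgMax (dual_numbers K)) = card (RgMax dual_pairs)"
    by (rule bij_betw_finite, rule bij_betw_same_card)
  then show ?thesis using finite_card_RgMax_dual_pairs by simp
qed

end
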